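(* For the Friedrichs model, the function $M_B$ is determined by the resolvent of $A_B$ restricted to the detectable subspace. Precisely: for $j=1,2$ let $\phi_j,\psi_j\in L^2(\mathbb R)$ and $B_j\in\mathbb C$, let $A^{(j)}_{B_j}$, $M^{(j)}_{B_j}$ and $\overline{\mathcal S}^{(j)}$ be the operator $A_B$, the $M$-function and the detectable subspace of the Friedrichs model with data $(\phi_j,\psi_j,B_j)$, and assume $\rho(A^{(j)}_{B_j})\neq\emptyset$. Suppose that $\overline{\mathcal S}^{(1)}=\overline{\mathcal S}^{(2)}=:\overline{\mathcal S}$, that $\rho(A^{(1)}_{B_1})\setminus\mathbb R=\rho(A^{(2)}_{B_2})\setminus\mathbb R=:\rho_0$, and that $$\left.(A^{(1)}_{B_1}-\lambda)^{-1}\right|_{\overline{\mathcal S}}=\left.(A^{(2)}_{B_2}-\lambda)^{-1}\right|_{\overline{\mathcal S}}\qquad\text{for all }\lambda\in\rho_0 .$$ Then $M^{(1)}_{B_1}(\lambda)=M^{(2)}_{B_2}(\lambda)$ for all $\lambda\in\rho_0$.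
   Context: Friedrichs model with data $(\phi,\psi,B)$, $\phi,\psi\in L^2(\mathbb R)$, $B\in\mathbb C$; $\langle f,g\rangle=\int_{\mathbb R}f\overline g\,dx$. Let $\mathcal D=\{f\in L^2(\mathbb R):\exists c_f\in\mathbb C,\ xf(x)-c_f\mathbf 1\in L^2(\mathbb R)\}$; $c_f$ is uniquely determined by $f$. Let $\widetilde A^*$ be the operator with domain $\mathcal D$ and $(\widetilde A^*f)(x)=xf(x)-c_f+\langle f,\phi\rangle\psi(x)$. Define $\Gamma_1,\Gamma_2:\mathcal D\to\mathbb C$ by $\Gamma_1u=\lim_{R\to\infty}\int_{-R}^Ru(x)\,dx$ and $\Gamma_2u=c_u$. The operator $A_B$ is the restriction of $\widetilde A^*$ to $\{u\in\mathcal D:\Gamma_1u=B\Gamma_2u\}$. For $\lambda\in\rho(A_B)$ the $M$-function $M_B(\lambda)\in\mathbb C$ is defined by $M_B(\lambda)(\Gamma_1-B\Gamma_2)u=\Gamma_2u$ for all $u\in\ker(\widetilde A^*-\lambda)$, and the solution operator $S_{\lambda,B}:\mathbb C\to\ker(\widetilde A^*-\lambda)$ is defined by $(\widetilde A^*-\lambda)S_{\lambda,B}f=0$, $(\Gamma_1-B\Gamma_2)S_{\lambda,B}f=f$. The detectable subspace $\overline{\mathcal S}$ is the closed linear span in $L^2(\mathbb R)$ of all $\mathrm{Ran}(S_{\lambda,B})$ with $B\in\mathbb C$ and $\lambda\in\rho(A_B)$; equivalently $\mathcal S^\perp=\bigcap_{B}\bigcap_{\lambda\in\rho(A_B)}\ker(S_{\lambda,B}^*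 )$. (Except for degenerate $B$, it coincides with the closed span of $\mathrm{Ran}(S_{\lambda,B})$ over $\lambda\in\rho(A_B)$ for one fixed $B$.) *)

theory Defs
  imports "HOL-Analysis.Analysis"
begin

section \<open>The complex Hilbert space \<open>L\<^sup>2(\<real>)\<close>\<close>

definition square_integrable :: "(real \<Rightarrow> complex) \<Rightarrow> bool" where
  "square_integrable f \<longleftrightarrow>
     f \<in> borel_measurable lborel \<and> integrable lborel (\<lambda>x. (cmod (f x))\<^sup>2)"

definition L2_rel :: "(real \<Rightarrow> complex) \<Rightarrow> (real \<Rightarrow> complex) \<Rightarrow> bool" where
  "L2_rel f g \<longleftrightarrow> square_integrable f \<and> square_integrable g \<and> (AE x in lborel. f x = g x)"

lemma square_integrable_zero: "square_integrable (\<lambda>_. 0)"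
  by (simp add: square_integrable_def)

lemma square_integrable_add:
  assumes "square_integrable f" "square_integrable g"
  shows "square_integrable (\<lambda>x. f x + g x)"
proof -
  have m [measurable]: "f \<in> borel_measurable lborel" "g \<in> borel_measurable lborel"
    using assms by (auto simp: square_integrable_def)
  have i: "integrable lborel (\<lambda>x. 2 * (cmod (f x))\<^sup>2 + 2 * (cmod (g x))\<^sup>2)"
    using assms by (auto simp: square_integrable_def)
  have b: "(cmod (f x + g x))\<^sup>2 \<le> 2 * (cmod (f x))\<^sup>2 + 2 * (cmod (g x))\<^sup>2" for x
  proof -
    have "(cmod (f x + g x))\<^sup>2 \<le> (cmod (f x) + cmod (g x))\<^sup>2"
      by (intro power_mono norm_triangle_ineq) auto
    also have "\<dots> \<le> 2 * (cmod (f x))\<^sup>2 + 2 * (cmod (g x))\<^sup>2"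
      using sum_squares_bound[of "cmod (f x)" "cmod (g x)"]
      by (simp add: power2_sum)
    finally show ?thesis .
  qed
  have "integrable lborel (\<lambda>x. (cmod (f x + g x))\<^sup>2)"
    by (rule Bochner_Integration.integrable_bound[OF i]) (use b in auto)
  then show ?thesis by (simp add: square_integrable_def)
qed

lemma square_integrable_mult_const:
  assumes "square_integrable f"
  shows "square_integrable (\<lambda>x. a * f x)"
  using assms by (auto simp: square_integrable_def norm_mult power_mult_distrib)

lemma integrable_mult_cnj:
  assumes "square_integrable f" "square_integrable g"
  shows "integrable lborel (\<lambda>x. f x * cnj (g x))"
proof -
  have m [measurable]: "f \<in> borel_measurable lborel" "g \<in> borel_measurable lborel"
    using assms by (auto simp: square_integrable_def)
  have m2 [measurable]: "(\<lambda>x. cnj (g x)) \<in> borel_measurable lborel"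
    by (rule borel_measurable_continuous_on[where f = cnj]) (auto intro: continuous_intros)
  have i: "integrable lborel (\<lambda>x. (cmod (f x))\<^sup>2 + (cmod (g x))\<^sup>2)"
    using assms by (auto simp: square_integrable_def)
  have b: "cmod (f x * cnj (g x)) \<le> (cmod (f x))\<^sup>2 + (cmod (g x))\<^sup>2" for x
  proof -
    have "2 * (cmod (f x) * cmod (g x)) \<le> (cmod (f x))\<^sup>2 + (cmod (g x))\<^sup>2"
      using sum_squares_bound[of "cmod (f x)" "cmod (g x)"] by (simp only: mult.assoc)
    moreover have "0 \<le> cmod (f x) * cmod (g x)" by simp
    ultimately show ?thesis unfolding norm_mult complex_mod_cnj by linarith
  qed
  show ?thesis
    by (rule Bochner_Integration.integrable_bound[OF i]) (use b in auto)
qed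

quotient_type L2 = "real \<Rightarrow> complex" / partial: L2_rel
proof (rule part_equivpI)
  show "\<exists>f. L2_rel f f"
    by (rule exI[of _ "\<lambda>_. 0"]) (simp add: L2_rel_def square_integrable_zero)
  show "symp L2_rel"
    by (auto simp: symp_def L2_rel_def)
  show "transp L2_rel"
    by (auto simp: transp_def L2_rel_def elim: AE_mp)
qed

lemma square_integrable_rep_L2: "square_integrable (rep_L2 f)"
  using Quotient3_rep_reflp[OF Quotient3_L2] by (simp add: L2_rel_def)

instantiation L2 :: ab_group_add
begin

lift_definition zero_L2 :: L2 is "\<lambda>_. 0"
  by (simp add: L2_rel_def square_integrable_zero)

lift_definition plus_L2 :: "L2 \<Rightarrow> L2 \<Rightarrow> L2" is "\<lambda>f g x. f x + g x"
  by (auto simp: L2_rel_def square_integrable_add)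

lift_definition uminus_L2 :: "L2 \<Rightarrow> L2" is "\<lambda>f x. - f x"
  by (auto simp: L2_rel_def square_integrable_def)

definition minus_L2 :: "L2 \<Rightarrow> L2 \<Rightarrow> L2" where
  "minus_L2 f g = f + (- g)"

instance
proof
  fix a b c :: L2
  show "a + b + c = a + (b + c)"
    by transfer (auto simp: L2_rel_def algebra_simps intro!: square_integrable_add)
  show "a + b = b + a"
    by transfer (auto simp: L2_rel_def algebra_simps intro!: square_integrable_add)
  show "0 + a = a"
    by transfer (auto simp: L2_rel_def)
  show "- a + a = 0"
    by transfer (auto simp: L2_rel_def square_integrable_zero)
  show "a - b = a + - b"
    by (rule minus_L2_def)
qed

end

lift_definition scaleC_L2 :: "complex \<Rightarrow> L2 \<Rightarrow> L2"  (infixr \<open>*\<^sub>C\<close> 75)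
  is "\<lambda>a f x. a * f x"
  by (auto simp: L2_rel_def square_integrable_mult_const)

lift_definition cinner_L2 :: "L2 \<Rightarrow> L2 \<Rightarrow> complex"
  is "\<lambda>f g. \<integral>x. f x * cnj (g x) \<partial>lborel"
proof -
  fix f f' g g'
  assume "L2_rel f f'" "L2_rel g g'"
  then have "square_integrable f" "square_integrable g" "square_integrable f'"
      "square_integrable g'" and ae: "AE x in lborel. f x = f' x" "AE x in lborel. g x = g' x"
    by (auto simp: L2_rel_def)
  then have "(\<lambda>x. f x * cnj (g x)) \<in> borel_measurable lborel"
      "(\<lambda>x. f' x * cnj (g' x)) \<in> borel_measurable lborel"
    by (blast intro: borel_measurable_integrable integrable_mult_cnj)+
  then show "(\<integral>x. f x * cnj (g x) \<partial>lborel) = (\<integral>x. f' x * cnj (g' x) \<partial>lborel)"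
    by (rule integral_cong_AE) (use ae in auto)
qed

global_interpretation L2: vector_space scaleC_L2
proof
  fix a b :: complex and f g :: L2
  show "a *\<^sub>C (f + g) = a *\<^sub>C f + a *\<^sub>C g"
    by transfer (auto simp: L2_rel_def algebra_simps
      intro!: square_integrable_add square_integrable_mult_const)
  show "(a + b) *\<^sub>C f = a *\<^sub>C f + b *\<^sub>C f"
    by transfer (auto simp: L2_rel_def algebra_simps
      intro!: square_integrable_add square_integrable_mult_const)
  show "a *\<^sub>C b *\<^sub>C f = (a * b) *\<^sub>C f"
    by transfer (auto simp: L2_rel_def algebra_simps intro!: square_integrable_mult_const)
  show "1 *\<^sub>C f = f"
    by transfer (auto simp: L2_rel_def)
qed

lemma cinner_L2_add_left: "cinner_L2 (f + g) h = cinner_L2 f h + cinner_L2 g h"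
  by transfer (auto simp: L2_rel_def algebra_simps integrable_mult_cnj)

lemma cinner_L2_scaleC_left: "cinner_L2 (a *\<^sub>C f) g = a * cinner_L2 f g"
  by transfer (auto simp: L2_rel_def mult.assoc integrable_mult_cnj)

lemma cinner_L2_commute: "cinner_L2 f g = cnj (cinner_L2 g f)"
proof transfer
  fix f g :: "real \<Rightarrow> complex"
  have "(\<integral>x. f x * cnj (g x) \<partial>lborel) = (\<integral>x. cnj (g x * cnj (f x)) \<partial>lborel)"
    by (simp add: mult.commute)
  also have "\<dots> = cnj (\<integral>x. g x * cnj (f x) \<partial>lborel)"
    by (rule Bochner_Integration.integral_cnj)
  finally show "(\<integral>x. f x * cnj (g x) \<partial>lborel) = cnj (\<integral>x. g x * cnj (f x) \<partial>lborel)" .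
qed

lemma cinner_L2_self: "cinner_L2 f f = complex_of_real (\<integral>x. (cmod (rep_L2 f x))\<^sup>2 \<partial>lborel)"
proof -
  have "cinner_L2 f f = (\<integral>x. rep_L2 f x * cnj (rep_L2 f x) \<partial>lborel)"
    by (simp add: cinner_L2_def)
  also have "\<dots> = (\<integral>x. complex_of_real ((cmod (rep_L2 f x))\<^sup>2) \<partial>lborel)"
    by (intro Bochner_Integration.integral_cong refl) (simp only: complex_norm_square)
  finally show ?thesis by (simp only: integral_complex_of_real)
qed

text \<open>The real inner product is the real part of the complex one, so that the norm and the
  topology on \<^typ>\<open>L2\<close> are the usual ones.\<close>

instantiation L2 :: real_inner
begin

definition scaleR_L2 :: "real \<Rightarrow> L2 \<Rightarrow> L2" where
  "scaleR_L2 r f = complex_of_real r *\<^sub>C f"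

definition inner_L2 :: "L2 \<Rightarrow> L2 \<Rightarrow> real" where
  "inner_L2 f g = Re (cinner_L2 f g)"

definition norm_L2 :: "L2 \<Rightarrow> real" where
  "norm_L2 f = sqrt (inner f f)"

definition sgn_L2 :: "L2 \<Rightarrow> L2" where
  "sgn_L2 f = inverse (norm f) *\<^sub>R f"

definition dist_L2 :: "L2 \<Rightarrow> L2 \<Rightarrow> real" where
  "dist_L2 f g = norm (f - g)"

definition uniformity_L2 :: "(L2 \<times> L2) filter" where
  "uniformity_L2 = (INF e\<in>{0<..}. principal {(f, g). dist f g < e})"

definition open_L2 :: "L2 set \<Rightarrow> bool" where
  "open_L2 U \<longleftrightarrow> (\<forall>f\<in>U. eventually (\<lambda>(f', g). f' = f \<longrightarrow> g \<in> U) uniformity)"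

instance
proof
  fix f g h :: L2 and a b :: real and U :: "L2 set"
  show "a *\<^sub>R (f + g) = a *\<^sub>R f + a *\<^sub>R g"
    by (simp add: scaleR_L2_def L2.scale_right_distrib)
  show "(a + b) *\<^sub>R f = a *\<^sub>R f + b *\<^sub>R f"
    by (simp add: scaleR_L2_def L2.scale_left_distrib)
  show "a *\<^sub>R b *\<^sub>R f = (a * b) *\<^sub>R f"
    by (simp add: scaleR_L2_def)
  show "1 *\<^sub>R f = f"
    by (simp add: scaleR_L2_def)
  show "inner f g = inner g f"
    unfolding inner_L2_def by (subst cinner_L2_commute) simp
  show "inner (f + g) h = inner f h + inner g h"
    by (simp add: inner_L2_def cinner_L2_add_left)
  show "inner (a *\<^sub>R f) g = a * inner f g"
    by (simp add: inner_L2_def scaleR_L2_def cinner_L2_scaleC_left)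
  show "0 \<le> inner f f"
    by (simp add: inner_L2_def cinner_L2_self)
  show "inner f f = 0 \<longleftrightarrow> f = 0"
  proof
    assume "inner f f = 0"
    then have "(\<integral>x. (cmod (rep_L2 f x))\<^sup>2 \<partial>lborel) = 0"
      by (simp add: inner_L2_def cinner_L2_self)
    then have "AE x in lborel. (cmod (rep_L2 f x))\<^sup>2 = 0"
      using square_integrable_rep_L2[of f]
      by (subst (asm) integral_nonneg_eq_0_iff_AE) (auto simp: square_integrable_def)
    then have "L2_rel (rep_L2 f) (\<lambda>_. 0)"
      using square_integrable_rep_L2[of f] by (simp add: L2_rel_def square_integrable_zero)
    then have "abs_L2 (rep_L2 f) = abs_L2 (\<lambda>_. 0)"
      using Quotient3_rel[OF Quotient3_L2] by blast
    then show "f = 0"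
      by (simp add: zero_L2_def Quotient3_abs_rep[OF Quotient3_L2])
  next
    assume "f = 0"
    have "cinner_L2 (0 :: L2) 0 = 0" by transfer simp
    then show "inner f f = 0" using \<open>f = 0\<close> by (simp add: inner_L2_def)
  qed
  show "norm f = sqrt (inner f f)"
    by (rule norm_L2_def)
  show "sgn f = inverse (norm f) *\<^sub>R f"
    by (rule sgn_L2_def)
  show "dist f g = norm (f - g)"
    by (rule dist_L2_def)
  show "uniformity = (INF e\<in>{0<..}. principal {(f :: L2, g). dist f g < e})"
    by (rule uniformity_L2_def)
  show "open U \<longleftrightarrow> (\<forall>f\<in>U. \<forall>\<^sub>F (f', g) in uniformity. f' = f \<longrightarrow> g \<in> U)"
    by (simp add: open_L2_def case_prod_unfold)
qed

end


section \<open>Unbounded operators\<close>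

text \<open>An operator \<open>T\<close> with domain \<open>D\<close> is given by a set and a function
  of which only the values on \<open>D\<close> matter.\<close>

definition op_kernel :: "L2 set \<Rightarrow> (L2 \<Rightarrow> L2) \<Rightarrow> complex \<Rightarrow> L2 set" where
  "op_kernel D T z = {u \<in> D. T u - z *\<^sub>C u = 0}"

definition resolvent_set :: "L2 set \<Rightarrow> (L2 \<Rightarrow> L2) \<Rightarrow> complex set" where
  "resolvent_set D T =
     {z. bij_betw (\<lambda>u. T u - z *\<^sub>C u) D UNIV \<and>
         (\<exists>C. \<forall>u\<in>D. norm u \<le> C * norm (T u - z *\<^sub>C u))}"

definition resolvent :: "L2 set \<Rightarrow> (L2 \<Rightarrow> L2) \<Rightarrow> complex \<Rightarrow> L2 \<Rightarrow> L2" where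
  "resolvent D T z = inv_into D (\<lambda>u. T u - z *\<^sub>C u)"


section \<open>The Friedrichs model\<close>

definition Friedrichs_dom :: "L2 set" where
  "Friedrichs_dom = {f. \<exists>c. square_integrable (\<lambda>x. complex_of_real x * rep_L2 f x - c)}"

text \<open>This is the constant \<open>c\<^sub>f\<close>.\<close>

definition Gamma2 :: "L2 \<Rightarrow> complex" where
  "Gamma2 f = (THE c. square_integrable (\<lambda>x. complex_of_real x * rep_L2 f x - c))"

lemma square_integrable_const_iff: "square_integrable (\<lambda>_. c) \<longleftrightarrow> c = 0"
  by (auto simp: square_integrable_def integrable_iff_bounded ennreal_mult_top split: if_splits)

lemma Gamma2_eqI:
  assumes "square_integrable (\<lambda>x. complex_of_real x * rep_L2 f x - c)"
  shows "Gamma2 f = c"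
  unfolding Gamma2_def
proof (rule the_equality)
  fix d assume "square_integrable (\<lambda>x. complex_of_real x * rep_L2 f x - d)"
  then have "square_integrable (\<lambda>x. - 1 * (complex_of_real x * rep_L2 f x - d))"
    by (rule square_integrable_mult_const)
  from square_integrable_add[OF assms this] have "square_integrable (\<lambda>_. d - c)"
    by (simp add: algebra_simps)
  then show "d = c" by (simp add: square_integrable_const_iff)
qed (fact assms)

definition Gamma1 :: "L2 \<Rightarrow> complex" where
  "Gamma1 f = Lim at_top (\<lambda>R::real. LINT x:{-R..R}|lborel. rep_L2 f x)"

text \<open>Outside \<^const>\<open>Friedrichs_dom\<close> the function below is not square integrable, so its
  class under \<^const>\<open>abs_L2\<close> is unspecified; the operator is only ever used on (subsets of)
  \<^const>\<open>Friedrichs_dom\<close>.\<close>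

definition A_tilde_star :: "L2 \<Rightarrow> L2 \<Rightarrow> L2 \<Rightarrow> L2" where
  "A_tilde_star \<phi> \<psi> f =
     abs_L2 (\<lambda>x. complex_of_real x * rep_L2 f x - Gamma2 f) + cinner_L2 f \<phi> *\<^sub>C \<psi>"

definition A_dom :: "complex \<Rightarrow> L2 set" where
  "A_dom B = {u \<in> Friedrichs_dom. Gamma1 u = B * Gamma2 u}"

definition A_rho :: "L2 \<Rightarrow> L2 \<Rightarrow> complex \<Rightarrow> complex set" where
  "A_rho \<phi> \<psi> B = resolvent_set (A_dom B) (A_tilde_star \<phi> \<psi>)"

definition A_resolvent :: "L2 \<Rightarrow> L2 \<Rightarrow> complex \<Rightarrow> complex \<Rightarrow> L2 \<Rightarrow> L2" where
  "A_resolvent \<phi> \<psi> B z = resolvent (A_dom B) (A_tilde_star \<phi> \<psi>) z"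

definition M_function :: "L2 \<Rightarrow> L2 \<Rightarrow> complex \<Rightarrow> complex \<Rightarrow> complex" where
  "M_function \<phi> \<psi> B z =
     (THE m. \<forall>u \<in> op_kernel Friedrichs_dom (A_tilde_star \<phi> \<psi>) z.
        m * (Gamma1 u - B * Gamma2 u) = Gamma2 u)"

definition solution_op :: "L2 \<Rightarrow> L2 \<Rightarrow> complex \<Rightarrow> complex \<Rightarrow> complex \<Rightarrow> L2" where
  "solution_op \<phi> \<psi> B z a =
     (THE u. u \<in> op_kernel Friedrichs_dom (A_tilde_star \<phi> \<psi>) z \<and> Gamma1 u - B * Gamma2 u = a)"

definition detectable_subspace :: "L2 \<Rightarrow> L2 \<Rightarrow> L2 set" where
  "detectable_subspace \<phi> \<psi> =
     closure (L2.span (\<Union>B. \<Union>z \<in> A_rho \<phi> \<psi> B. range (solution_op \<phi> \<psi> B z)))"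

end

theory Submission
  imports Defs "HOL-Probability.Sinc_Integral"
begin

text \<open>
  For nonreal \<open>\<mu>\<close> in both resolvent sets let \<open>v\<close> span the kernel of \<open>A\<^sub>1 - \<mu>\<close>, where \<open>A\<^sub>1, A\<^sub>2\<close>
  denote the two maximal operators; \<open>v\<close> lies in the detectable subspace.  The resolvent of the first
  model at \<open>\<lambda>\<close> maps \<open>v\<close> to \<open>(v - a w) / (\<mu> - \<lambda>)\<close>, where \<open>w\<close> spans the kernel of \<open>A\<^sub>1 - \<lambda>\<close>.  As the
  resolvents agree there, \<open>A\<^sub>1\<close> and \<open>A\<^sub>2\<close>, hence \<open>\<langle>\<cdot>, \<phi>\<^sub>1\<rangle> \<psi>\<^sub>1\<close> and \<open>\<langle>\<cdot>, \<phi>\<^sub>2\<rangle> \<psi>\<^sub>2\<close>, coincide on \<open>v - a w\<close>.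
  For \<open>\<lambda> = it\<close>, \<open>t \<rightarrow> \<plusminus>\<infinity>\<close>, explicit formulas give \<open>a w \<rightarrow> 0\<close> in at least one of the two directions,
  so the two rank-one terms coincide on \<open>v\<close> and \<open>v\<close> is also in the kernel of \<open>A\<^sub>2 - \<mu>\<close>.  As
  \<open>M\<^sub>B(\<mu>) = \<Gamma>\<^sub>2 v / (\<Gamma>\<^sub>1 v - B \<Gamma>\<^sub>2 v)\<close>, this settles the case \<open>B\<^sub>1 = B\<^sub>2\<close>.  If \<open>B\<^sub>1 \<noteq> B\<^sub>2\<close>, both boundary values of \<open>v - a w\<close> vanish, so
  \<open>\<Gamma>\<^sub>1 v / \<Gamma>\<^sub>2 v = \<Gamma>\<^sub>1 w / \<Gamma>\<^sub>2 w\<close>, which tends to \<open>\<plusminus>i\<pi>\<close> as \<open>t \<rightarrow> \<plusminus>\<infinity>\<close>: a contradiction.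
\<close>

section \<open>Representatives of elements of \<open>L\<^sup>2\<close>\<close>

lemma square_integrable_cong_AE:
  assumes "square_integrable f" "g \<in> borel_measurable lborel" "AE x in lborel. f x = g x"
  shows "square_integrable g"
proof -
  have "integrable lborel (\<lambda>x. (cmod (g x))\<^sup>2)"
    using assms unfolding square_integrable_def
    by (subst integrable_cong_AE[where g = "\<lambda>x. (cmod (f x))\<^sup>2"]) auto
  with assms(2) show ?thesis by (simp add: square_integrable_def)
qed

lemma abs_L2_eqI:
  assumes "square_integrable f" "square_integrable g" "AE x in lborel. f x = g x"
  shows "abs_L2 f = abs_L2 g"
  using assms Quotient3_rel[OF Quotient3_L2, of f g] by (simp add: L2_rel_def)

text \<open>\<open>rep_L2\<close> selects an arbitrary member of the class, so pointwise formulas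
  survive only almost everywhere. Every later identity in L2 passes through this fact and
  \<open>L2_eqI\<close>.\<close>

lemma AE_rep_abs_L2:
  assumes "square_integrable f"
  shows "AE x in lborel. rep_L2 (abs_L2 f) x = f x"
  using rep_abs_rsp_left[OF Quotient3_L2, of f f] assms by (simp add: L2_rel_def)

lemma L2_eqI:
  assumes "AE x in lborel. rep_L2 f x = rep_L2 g x"
  shows "f = g"
  using abs_L2_eqI[OF square_integrable_rep_L2 square_integrable_rep_L2 assms]
  by (simp add: Quotient3_abs_rep[OF Quotient3_L2])

lemma AE_rep_plus_L2: "AE x in lborel. rep_L2 (f + g) x = rep_L2 f x + rep_L2 g x"
  unfolding plus_L2_def map_fun_apply
  by (intro AE_rep_abs_L2 square_integrable_add square_integrable_rep_L2)

lemma AE_rep_scaleC_L2: "AE x in lborel. rep_L2 (a *\<^sub>C f) x = a * rep_L2 f x"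
  unfolding scaleC_L2_def map_fun_apply id_apply
  by (intro AE_rep_abs_L2 square_integrable_mult_const square_integrable_rep_L2)

lemma rep_L2_measurable [measurable]: "rep_L2 f \<in> borel_measurable borel"
  using square_integrable_rep_L2[of f] by (simp add: square_integrable_def)

lemma minus_eq_scaleC: "- f = (- 1) *\<^sub>C (f :: L2)"
  by (metis L2.scale_minus_left L2.scale_one)

lemma cinner_L2_minus_left: "cinner_L2 (- f) g = - cinner_L2 f g"
  unfolding minus_eq_scaleC cinner_L2_scaleC_left by simp

lemma cinner_L2_diff_left: "cinner_L2 (f - g) h = cinner_L2 f h - cinner_L2 g h"
  by (simp only: diff_conv_add_uminus cinner_L2_add_left cinner_L2_minus_left)

lemma norm_L2_power2: "(norm f)\<^sup>2 = (\<integral>x. (cmod (rep_L2 f x))\<^sup>2 \<partial>lborel)"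
  by (simp add: power2_norm_eq_inner inner_L2_def cinner_L2_self)

lemma norm_scaleC_L2: "norm (a *\<^sub>C f) = cmod a * norm (f :: L2)"
proof (rule power2_eq_imp_eq)
  have "(norm (a *\<^sub>C f))\<^sup>2 = (\<integral>x. (cmod a)\<^sup>2 * (cmod (rep_L2 f x))\<^sup>2 \<partial>lborel)"
    unfolding norm_L2_power2 using AE_rep_scaleC_L2[of a f]
    by (intro integral_cong_AE) (auto simp: norm_mult power_mult_distrib)
  then show "(norm (a *\<^sub>C f))\<^sup>2 = (cmod a * norm f)\<^sup>2"
    by (simp add: norm_L2_power2 power_mult_distrib)
qed auto

text \<open>Complex Cauchy-Schwarz follows from the real one: rotating \<open>f\<close> by a
  unimodular factor makes the complex inner product a nonnegative real number, which is then the
  real inner product.\<close>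

lemma cmod_cinner_L2_le: "cmod (cinner_L2 f g) \<le> norm f * norm g"
proof (cases "cinner_L2 f g = 0")
  case False
  define a where "a = cnj (sgn (cinner_L2 f g))"
  have a: "cmod a = 1" using False by (simp add: a_def norm_sgn)
  have "cnj w * w = complex_of_real (cmod w) * complex_of_real (cmod w)" for w
    using complex_norm_square[of w] by (simp add: power2_eq_square mult.commute[of w])
  then have "cinner_L2 (a *\<^sub>C f) g = cmod (cinner_L2 f g)"
    using False by (simp add: a_def cinner_L2_scaleC_left sgn_eq)
  then have "cmod (cinner_L2 f g) = inner (a *\<^sub>C f) g" by (simp add: inner_L2_def)
  also have "\<dots> \<le> norm (a *\<^sub>C f) * norm g" by (rule norm_cauchy_schwarz)
  finally show ?thesis by (simp add: norm_scaleC_L2 a)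
qed simp

section \<open>Multiplication by \<open>1 / (x - it)\<close>\<close>

text \<open>This is the symbol of the resolvent of multiplication by \<open>x\<close> at the point
  \<open>it\<close>. The imaginary axis suffices because the argument only takes limits along
  it.\<close>

definition kern :: "real \<Rightarrow> real \<Rightarrow> complex" where
  "kern t x = 1 / (complex_of_real x - \<i> * complex_of_real t)"

text \<open>For \<open>t = 0\<close> the function is not square integrable and its class is
  unspecified, hence the recurring hypothesis \<open>t \<noteq> 0\<close>.\<close>

definition ker_L2 :: "real \<Rightarrow> L2" where
  "ker_L2 t = abs_L2 (kern t)"

definition mult_ker :: "real \<Rightarrow> L2 \<Rightarrow> L2" where
  "mult_ker t f = abs_L2 (\<lambda>x. kern t x * rep_L2 f x)"

lemma kern_denom_nonzero:
  assumes "t \<noteq> 0" shows "complex_of_real x - \<i> * complex_of_real t \<noteq> 0"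
  using assms by (auto simp: complex_eq_iff)

lemma cmod_kern_power2: "(cmod (kern t x))\<^sup>2 = 1 / (x\<^sup>2 + t\<^sup>2)"
  by (simp add: kern_def norm_divide power_divide cmod_power2)

lemma kern_measurable [measurable]: "kern t \<in> borel_measurable borel"
  unfolding kern_def by measurable

lemma cmod_kern_le:
  assumes "t \<noteq> 0" shows "cmod (kern t x) \<le> 1 / \<bar>t\<bar>"
proof (rule power2_le_imp_le)
  show "(cmod (kern t x))\<^sup>2 \<le> (1 / \<bar>t\<bar>)\<^sup>2"
    unfolding cmod_kern_power2 using assms by (simp add: power_divide frac_le)
qed simp

lemma integrable_inverse_1_plus_square_lborel:
  "integrable lborel (\<lambda>x::real. inverse (1 + x\<^sup>2))"
  using integrable_inverse_1_plus_square by (simp add: set_integrable_def)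

text \<open>The argument \<open>0 + t * x\<close> has the shape required by the affine change of
  variables for \<open>lborel\<close>; the substitution reduces all integrals to that of 1/(1 +
  x^2).\<close>

lemma cmod_kern_power2_affine:
  assumes "t \<noteq> 0"
  shows "(cmod (kern t (0 + t * x)))\<^sup>2 = inverse (1 + x\<^sup>2) / t\<^sup>2"
  unfolding cmod_kern_power2 using assms
  by (simp add: power_mult_distrib divide_simps add_nonneg_eq_0_iff) (simp add: algebra_simps)

lemma square_integrable_kern:
  assumes "t \<noteq> 0" shows "square_integrable (kern t)"
proof -
  have "integrable lborel (\<lambda>x. (cmod (kern t (0 + t * x)))\<^sup>2)"
    unfolding cmod_kern_power2_affine[OF assms]
    using integrable_inverse_1_plus_square_lborel by simp
  then have "integrable lborel (\<lambda>x. (cmod (kern t x))\<^sup>2)"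
    using lborel_integrable_real_affine_iff[OF assms, of "\<lambda>x. (cmod (kern t x))\<^sup>2" 0] by simp
  then show ?thesis by (simp add: square_integrable_def)
qed

lemma square_integrable_kern_mult:
  assumes "t \<noteq> 0" shows "square_integrable (\<lambda>x. kern t x * rep_L2 f x)"
  unfolding square_integrable_def
proof
  have "integrable lborel (\<lambda>x. (1 / \<bar>t\<bar>)\<^sup>2 * (cmod (rep_L2 f x))\<^sup>2)"
    using square_integrable_rep_L2[of f] by (simp add: square_integrable_def)
  then show "integrable lborel (\<lambda>x. (cmod (kern t x * rep_L2 f x))\<^sup>2)"
  proof (rule Bochner_Integration.integrable_bound)
    show "AE x in lborel. norm ((cmod (kern t x * rep_L2 f x))\<^sup>2)
        \<le> norm ((1 / \<bar>t\<bar>)\<^sup>2 * (cmod (rep_L2 f x))\<^sup>2)"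
      using cmod_kern_le[OF assms]
      by (auto simp: norm_mult power_mult_distrib simp del: power_divide
          intro!: AE_I2 mult_right_mono power_mono)
  qed auto
qed auto

lemma AE_rep_ker_L2:
  assumes "t \<noteq> 0" shows "AE x in lborel. rep_L2 (ker_L2 t) x = kern t x"
  unfolding ker_L2_def by (rule AE_rep_abs_L2[OF square_integrable_kern[OF assms]])

lemma AE_rep_mult_ker:
  assumes "t \<noteq> 0" shows "AE x in lborel. rep_L2 (mult_ker t f) x = kern t x * rep_L2 f x"
  unfolding mult_ker_def by (rule AE_rep_abs_L2[OF square_integrable_kern_mult[OF assms]])

text \<open>The substitution contributes |t| and the integrand 1/t^2. The constant stays an
  unevaluated integral, since only the decay in \<open>t\<close> matters.\<close>

lemma norm_ker_L2_power2:
  assumes "t \<noteq> 0"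
  shows "(norm (ker_L2 t))\<^sup>2 = (\<integral>x. inverse (1 + x\<^sup>2) \<partial>lborel) / \<bar>t\<bar>"
proof -
  have "(norm (ker_L2 t))\<^sup>2 = (\<integral>x. (cmod (kern t x))\<^sup>2 \<partial>lborel)"
    unfolding norm_L2_power2 using AE_rep_ker_L2[OF assms] by (intro integral_cong_AE) auto
  also have "\<dots> = \<bar>t\<bar> *\<^sub>R (\<integral>x. inverse (1 + x\<^sup>2) / t\<^sup>2 \<partial>lborel)"
    by (subst lborel_integral_real_affine[OF assms, of _ 0])
      (simp only: cmod_kern_power2_affine[OF assms])
  also have "\<dots> = \<bar>t\<bar> * ((\<integral>x. inverse (1 + x\<^sup>2) \<partial>lborel) / \<bar>t\<bar>\<^sup>2)" by simp
  also have "\<dots> = (\<integral>x. inverse (1 + x\<^sup>2) \<partial>lborel) / \<bar>t\<bar>"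
    by (simp only: power2_eq_square times_divide_eq_right mult_divide_mult_cancel_left assms
        abs_eq_0 not_False_eq_True)
  finally show ?thesis .
qed

lemma norm_mult_ker_le:
  assumes "t \<noteq> 0" shows "norm (mult_ker t f) \<le> norm f / \<bar>t\<bar>"
proof (rule power2_le_imp_le)
  have "(norm (mult_ker t f))\<^sup>2 = (\<integral>x. (cmod (kern t x * rep_L2 f x))\<^sup>2 \<partial>lborel)"
    unfolding norm_L2_power2 using AE_rep_mult_ker[OF assms, of f]
    by (intro integral_cong_AE) (measurable, auto elim!: eventually_mono)
  also have "\<dots> \<le> (\<integral>x. (1 / \<bar>t\<bar>)\<^sup>2 * (cmod (rep_L2 f x))\<^sup>2 \<partial>lborel)"
    using square_integrable_kern_mult[OF assms, of f] square_integrable_rep_L2[of f]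
      cmod_kern_le[OF assms]
    by (intro integral_mono)
      (auto simp: square_integrable_def norm_mult power_mult_distrib simp del: power_divide
          intro!: mult_right_mono power_mono)
  also have "\<dots> = (norm f / \<bar>t\<bar>)\<^sup>2"
    by (simp add: norm_L2_power2 power_divide)
  finally show "(norm (mult_ker t f))\<^sup>2 \<le> (norm f / \<bar>t\<bar>)\<^sup>2" .
qed simp

lemma mult_ker_add:
  assumes "t \<noteq> 0" shows "mult_ker t (f + g) = mult_ker t f + mult_ker t g"
proof (rule L2_eqI)
  show "AE x in lborel. rep_L2 (mult_ker t (f + g)) x = rep_L2 (mult_ker t f + mult_ker t g) x"
    using AE_rep_mult_ker[OF assms, of f] AE_rep_mult_ker[OF assms, of g]
      AE_rep_mult_ker[OF assms, of "f + g"] AE_rep_plus_L2[of f g]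
      AE_rep_plus_L2[of "mult_ker t f" "mult_ker t g"]
    by eventually_elim (simp add: distrib_left)
qed

lemma mult_ker_scaleC:
  assumes "t \<noteq> 0" shows "mult_ker t (a *\<^sub>C f) = a *\<^sub>C mult_ker t f"
proof (rule L2_eqI)
  show "AE x in lborel. rep_L2 (mult_ker t (a *\<^sub>C f)) x = rep_L2 (a *\<^sub>C mult_ker t f) x"
    using AE_rep_mult_ker[OF assms, of f] AE_rep_mult_ker[OF assms, of "a *\<^sub>C f"]
      AE_rep_scaleC_L2[of a f] AE_rep_scaleC_L2[of a "mult_ker t f"]
    by eventually_elim simp
qed

lemma mult_ker_diff:
  assumes "t \<noteq> 0" shows "mult_ker t (f - g) = mult_ker t f - mult_ker t g"
  by (simp only: diff_conv_add_uminus mult_ker_add[OF assms] minus_eq_scaleC mult_ker_scaleC[OF assms])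

section \<open>The domain and the boundary functionals\<close>

text \<open>Here u = (h + c)/(x - it), so xu - c = h + it u is square integrable. This one identity
  yields the domain, \<open>Gamma2\<close> and the action of the operator.\<close>

lemma Friedrichs_dom_mult_ker:
  assumes t: "t \<noteq> 0"
  shows "mult_ker t h + c *\<^sub>C ker_L2 t \<in> Friedrichs_dom" (is "?u \<in> _")
    and "Gamma2 (mult_ker t h + c *\<^sub>C ker_L2 t) = c"
    and "A_tilde_star \<phi> \<psi> (mult_ker t h + c *\<^sub>C ker_L2 t)
        - (\<i> * of_real t) *\<^sub>C (mult_ker t h + c *\<^sub>C ker_L2 t)
      = h + cinner_L2 (mult_ker t h + c *\<^sub>C ker_L2 t) \<phi> *\<^sub>C \<psi>"
proof -
  have ae: "AE x in lborel. rep_L2 h x + \<i> * of_real t * rep_L2 ?u x = of_real x * rep_L2 ?u x - c"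
    using AE_rep_mult_ker[OF t, of h] AE_rep_ker_L2[OF t] AE_rep_scaleC_L2[of c "ker_L2 t"]
      AE_rep_plus_L2[of "mult_ker t h" "c *\<^sub>C ker_L2 t"]
  proof eventually_elim
    case (elim x)
    have "rep_L2 ?u x = kern t x * (rep_L2 h x + c)"
      using elim by (simp add: algebra_simps)
    then have "(of_real x - \<i> * of_real t) * rep_L2 ?u x = rep_L2 h x + c"
      using kern_denom_nonzero[OF t, of x] by (simp add: kern_def)
    then show ?case by (simp add: algebra_simps)
  qed
  have si: "square_integrable (\<lambda>x. rep_L2 h x + \<i> * of_real t * rep_L2 ?u x)"
    by (intro square_integrable_add square_integrable_mult_const square_integrable_rep_L2)
  have si': "square_integrable (\<lambda>x. of_real x * rep_L2 ?u x - c)"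
    by (rule square_integrable_cong_AE[OF si _ ae]) measurable
  show "?u \<in> Friedrichs_dom" using si' by (auto simp: Friedrichs_dom_def)
  show G: "Gamma2 ?u = c" by (rule Gamma2_eqI[OF si'])
  have "AE x in lborel. rep_L2 (abs_L2 (\<lambda>x. of_real x * rep_L2 ?u x - c)) x
      = rep_L2 (h + (\<i> * of_real t) *\<^sub>C ?u) x"
    using AE_rep_abs_L2[OF si'] ae AE_rep_plus_L2[of h "(\<i> * of_real t) *\<^sub>C ?u"]
      AE_rep_scaleC_L2[of "\<i> * of_real t" ?u]
    by eventually_elim simp
  then have "abs_L2 (\<lambda>x. of_real x * rep_L2 ?u x - c) = h + (\<i> * of_real t) *\<^sub>C ?u"
    by (rule L2_eqI)
  then show "A_tilde_star \<phi> \<psi> ?u - (\<i> * of_real t) *\<^sub>C ?u = h + cinner_L2 ?u \<phi> *\<^sub>C \<psi>"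
    by (simp add: A_tilde_star_def G)
qed

text \<open>Taking h = (x - it)u - c inverts the previous construction, so the pairs (h, c)
  parametrise the whole domain for each fixed nonzero \<open>t\<close>.\<close>

lemma Friedrichs_domE:
  assumes u: "u \<in> Friedrichs_dom" and t: "t \<noteq> 0"
  obtains h where "u = mult_ker t h + Gamma2 u *\<^sub>C ker_L2 t"
proof -
  obtain c where si: "square_integrable (\<lambda>x. of_real x * rep_L2 u x - c)"
    using u by (auto simp: Friedrichs_dom_def)
  have c: "c = Gamma2 u" using Gamma2_eqI[OF si] by simp
  define a where "a = - \<i> * complex_of_real t"
  define h where "h = abs_L2 (\<lambda>x. of_real x * rep_L2 u x - c) + a *\<^sub>C u"
  have "AE x in lborel. rep_L2 u x = rep_L2 (mult_ker t h + c *\<^sub>C ker_L2 t) x"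
    using AE_rep_mult_ker[OF t, of h] AE_rep_ker_L2[OF t] AE_rep_scaleC_L2[of c "ker_L2 t"]
      AE_rep_plus_L2[of "mult_ker t h" "c *\<^sub>C ker_L2 t"]
      AE_rep_plus_L2[of "abs_L2 (\<lambda>x. of_real x * rep_L2 u x - c)" "a *\<^sub>C u", folded h_def]
      AE_rep_scaleC_L2[of a u] AE_rep_abs_L2[OF si]
  proof eventually_elim
    case (elim x)
    then have "rep_L2 (mult_ker t h + c *\<^sub>C ker_L2 t) x = kern t x * (rep_L2 h x + c)"
      by (simp only: distrib_left mult.commute[of c])
    moreover have "rep_L2 h x + c = (of_real x - \<i> * of_real t) * rep_L2 u x"
      using elim by (simp add: a_def left_diff_distrib)
    ultimately show ?case
      using t kern_denom_nonzero[OF t, of x] by (simp add: kern_def)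
  qed
  then have "u = mult_ker t h + c *\<^sub>C ker_L2 t" by (rule L2_eqI)
  with that c show ?thesis by blast
qed

section \<open>Symmetric integrals of the kernel and an explicit formula for
  \<open>Gamma1\<close>\<close>

lemma set_integral_kern:
  assumes t: "t \<noteq> 0" and R: "0 \<le> R"
  shows "set_integrable lborel {-R..R} (kern t)"
    and "(LINT x:{-R..R}|lborel. kern t x) = Complex 0 (2 * arctan (R / t))"
proof -
  \<comment> \<open>Up to an additive constant, \<open>F\<close> is a branch of log(x - it) on the
    real line. Its real part is even and cancels between -R and R.\<close>
  define F where "F x = Complex (ln (x\<^sup>2 + t\<^sup>2) / 2) (arctan (x / t))" for x
  have pos: "x\<^sup>2 + t\<^sup>2 > 0" for x using t by (simp add: add_nonneg_pos)
  have k: "kern t x = Complex (x / (x\<^sup>2 + t\<^sup>2)) (t / (x\<^sup>2 + t\<^sup>2))" for x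
    by (simp add: kern_def complex_eq_iff Re_divide Im_divide)
  have d: "(F has_vector_derivative kern t x) (at x within {-R..R})" for x
    unfolding k F_def has_vector_derivative_complex_iff complex.sel
  proof
    have four: "x\<^sup>2 * 4 + t\<^sup>2 * 4 = 4 * (x\<^sup>2 + t\<^sup>2)" by simp
    show "((\<lambda>x. ln (x\<^sup>2 + t\<^sup>2) / 2) has_field_derivative x / (x\<^sup>2 + t\<^sup>2)) (at x within {-R..R})"
      using pos[of x]
      by (auto intro!: derivative_eq_intros, simp only: four mult_divide_mult_cancel_left_if, simp)
    have "inverse (1 + (x / t)\<^sup>2) / t = t / (x\<^sup>2 + t\<^sup>2)"
      using t pos[of x] by (simp add: divide_simps power2_eq_square add.commute)
    then show "((\<lambda>x. arctan (x / t)) has_field_derivative t / (x\<^sup>2 + t\<^sup>2)) (at x within {-R..R})"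
      using t by (auto intro!: derivative_eq_intros)
  qed
  have c: "continuous_on {-R..R} (kern t)"
    unfolding kern_def using kern_denom_nonzero[OF t] by (intro continuous_intros) auto
  show "set_integrable lborel {-R..R} (kern t)"
    using borel_integrable_compact[OF _ c] by (simp add: set_integrable_def indicator_scaleR_eq_if)
  have "(LINT x:{-R..R}|lborel. kern t x) = F R - F (-R)"
    unfolding set_lebesgue_integral_def
    using R d c by (intro integral_FTC_Icc) auto
  also have "\<dots> = Complex 0 (2 * arctan (R / t))"
    by (simp add: F_def complex_eq_iff arctan_minus)
  finally show "(LINT x:{-R..R}|lborel. kern t x) = Complex 0 (2 * arctan (R / t))" .
qed

lemma tendsto_set_integral_kern:
  assumes t: "t \<noteq> 0"
  shows "((\<lambda>R. LINT x:{-R..R}|lborel. kern t x) \<longlongrightarrow> \<i> * of_real (pi * sgn t)) at_top"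
proof (rule Lim_transform_eventually)
  show "\<forall>\<^sub>F R in at_top. Complex 0 (2 * arctan (R / t)) = (LINT x:{-R..R}|lborel. kern t x)"
    using eventually_ge_at_top[of 0] by eventually_elim (simp add: set_integral_kern[OF t])
  have "((\<lambda>R. 2 * arctan (R / t)) \<longlongrightarrow> pi * sgn t) at_top"
  proof (cases "t > 0")
    case True then show ?thesis by real_asymp
  next
    case False with t have "t < 0" by simp then show ?thesis by real_asymp
  qed
  then have "((\<lambda>R. Complex 0 (2 * arctan (R / t))) \<longlongrightarrow> Complex 0 (pi * sgn t)) at_top"
    by (intro tendsto_Complex tendsto_const)
  then show "((\<lambda>R. Complex 0 (2 * arctan (R / t))) \<longlongrightarrow> \<i> * of_real (pi * sgn t)) at_top"
    by (simp add: complex_eq_iff Complex_eq)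
qed

text \<open>The part coming from \<open>h\<close> is a product of two L2 functions, hence
  integrable, and dominated convergence applies. The kernel itself enters only through its symmetric
  limit, which depends on the sign of \<open>t\<close>.\<close>

lemma Gamma1_mult_ker:
  assumes t: "t \<noteq> 0"
  shows "Gamma1 (mult_ker t h + c *\<^sub>C ker_L2 t)
    = cinner_L2 h (ker_L2 (- t)) + c * (\<i> * of_real (pi * sgn t))" (is "Gamma1 ?u = ?L")
proof -
  define f where "f x = rep_L2 h x * cnj (kern (- t) x)" for x
  \<comment> \<open>Conjugation in the second argument of the inner product explains why
    \<open>ker_L2 (- t)\<close> appears.\<close>
  have ck: "cnj (kern (- t) x) = kern t x" for x by (simp add: kern_def)
  have fi: "integrable lborel f"
    unfolding f_def using t
    by (intro integrable_mult_cnj square_integrable_rep_L2 square_integrable_kern) auto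
  have [measurable]: "f \<in> borel_measurable borel"
    using fi by (auto dest: borel_measurable_integrable)
  have ae: "AE x in lborel. rep_L2 ?u x = f x + c * kern t x"
    using AE_rep_mult_ker[OF t, of h] AE_rep_ker_L2[OF t] AE_rep_scaleC_L2[of c "ker_L2 t"]
      AE_rep_plus_L2[of "mult_ker t h" "c *\<^sub>C ker_L2 t"]
    by eventually_elim (simp add: f_def ck mult.commute)
  have "integral\<^sup>L lborel f = cinner_L2 h (ker_L2 (- t))"
    unfolding cinner_L2_def map_fun_apply id_apply f_def using AE_rep_ker_L2[of "- t"] t
    apply (intro integral_cong_AE)
    subgoal unfolding ck by measurable
    subgoal
      using integrable_mult_cnj[OF square_integrable_rep_L2 square_integrable_rep_L2,
          THEN borel_measurable_integrable]
      by blast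
    by auto
  moreover have "((\<lambda>R. LINT x:{-R..R}|lborel. f x) \<longlongrightarrow> integral\<^sup>L lborel f) at_top"
    unfolding set_lebesgue_integral_def
  proof (rule integral_dominated_convergence_at_top[where w = "\<lambda>x. norm (f x)"])
    show "AE x in lborel. ((\<lambda>R. indicat_real {-R..R} x *\<^sub>R f x) \<longlongrightarrow> f x) at_top"
    proof (rule AE_I2)
      fix x show "((\<lambda>R. indicat_real {-R..R} x *\<^sub>R f x) \<longlongrightarrow> f x) at_top"
        by (rule tendsto_eventually, rule eventually_mono[OF eventually_ge_at_top[of "\<bar>x\<bar>"]])
          (auto simp: indicator_def)
    qed
  qed (use fi in \<open>auto simp: indicator_def\<close>)
  ultimately have "((\<lambda>R. (LINT x:{-R..R}|lborel. f x) + c * (LINT x:{-R..R}|lborel. kern t x))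
      \<longlongrightarrow> ?L) at_top"
    using tendsto_set_integral_kern[OF t] by (auto intro!: tendsto_intros)
  then have "((\<lambda>R. LINT x:{-R..R}|lborel. rep_L2 ?u x) \<longlongrightarrow> ?L) at_top"
  proof (rule Lim_transform_eventually)
    show "\<forall>\<^sub>F R in at_top. (LINT x:{-R..R}|lborel. f x) + c * (LINT x:{-R..R}|lborel. kern t x)
        = (LINT x:{-R..R}|lborel. rep_L2 ?u x)"
      using eventually_ge_at_top[of 0]
    proof eventually_elim
      case (elim R)
      have "set_integrable lborel {-R..R} f"
        using integrable_mult_indicator[OF _ fi, of "{-R..R}"] by (simp add: set_integrable_def)
      then have "(LINT x:{-R..R}|lborel. f x) + c * (LINT x:{-R..R}|lborel. kern t x)
          = (LINT x:{-R..R}|lborel. f x + c * kern t x)"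
        using set_integral_kern(1)[OF t elim] by (subst set_integral_add(2)) auto
      also have "\<dots> = (LINT x:{-R..R}|lborel. rep_L2 ?u x)"
        unfolding set_lebesgue_integral_def using ae by (intro integral_cong_AE) auto
      finally show ?case .
    qed
  qed
  then show ?thesis unfolding Gamma1_def by (intro tendsto_Lim) auto
qed

section \<open>Linearity of the boundary functionals and of the maximal operator\<close>

lemma Friedrichs_dom_add_scaleC:
  assumes u: "u \<in> Friedrichs_dom" and v: "v \<in> Friedrichs_dom"
  shows "u + a *\<^sub>C v \<in> Friedrichs_dom"
    and "Gamma1 (u + a *\<^sub>C v) = Gamma1 u + a * Gamma1 v"
    and "Gamma2 (u + a *\<^sub>C v) = Gamma2 u + a * Gamma2 v"
    and "A_tilde_star \<phi> \<psi> (u + a *\<^sub>C v) = A_tilde_star \<phi> \<psi> u + a *\<^sub>C A_tilde_star \<phi> \<psi> v"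
proof -
  \<comment> \<open>The definitions by a limit and by definite description do not show linearity,
    but in the coordinates (h, c) at \<open>t = 1\<close> all formulas are linear.\<close>
  have 1: "(1::real) \<noteq> 0" by simp
  obtain h c where h: "u = mult_ker 1 h + c *\<^sub>C ker_L2 1"
    using Friedrichs_domE[OF u 1] by blast
  obtain k d where k: "v = mult_ker 1 k + d *\<^sub>C ker_L2 1"
    using Friedrichs_domE[OF v 1] by blast
  have w: "u + a *\<^sub>C v = mult_ker 1 (h + a *\<^sub>C k) + (c + a * d) *\<^sub>C ker_L2 1"
    unfolding h k mult_ker_add[OF 1] mult_ker_scaleC[OF 1]
    by (simp add: L2.scale_left_distrib L2.scale_right_distrib)
  show "u + a *\<^sub>C v \<in> Friedrichs_dom"
    unfolding w by (rule Friedrichs_dom_mult_ker(1)[OF 1])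
  show "Gamma2 (u + a *\<^sub>C v) = Gamma2 u + a * Gamma2 v"
    unfolding w unfolding h k Friedrichs_dom_mult_ker(2)[OF 1] ..
  show "Gamma1 (u + a *\<^sub>C v) = Gamma1 u + a * Gamma1 v"
    unfolding w unfolding h k Gamma1_mult_ker[OF 1] cinner_L2_add_left cinner_L2_scaleC_left
    by (simp add: algebra_simps)
  note A = Friedrichs_dom_mult_ker(3)[OF 1, of \<phi> \<psi>, unfolded diff_eq_eq]
  show "A_tilde_star \<phi> \<psi> (u + a *\<^sub>C v) = A_tilde_star \<phi> \<psi> u + a *\<^sub>C A_tilde_star \<phi> \<psi> v"
    unfolding A[of h c, folded h] A[of k d, folded k] A[of "h + a *\<^sub>C k" "c + a * d", folded w]
      cinner_L2_add_left cinner_L2_scaleC_left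
    by (simp add: L2.scale_left_distrib L2.scale_right_distrib mult.commute)
qed

lemma zero_in_Friedrichs_dom: "0 \<in> Friedrichs_dom" "Gamma2 0 = 0" "Gamma1 0 = 0"
    "A_tilde_star \<phi> \<psi> 0 = 0"
proof -
  have 1: "(1::real) \<noteq> 0" by simp
  have "mult_ker 1 0 = 0" using mult_ker_scaleC[OF 1, of 0 0] by simp
  then show 0: "0 \<in> Friedrichs_dom" using Friedrichs_dom_mult_ker(1)[OF 1, of 0 0] by simp
  show "Gamma2 0 = 0" using Friedrichs_dom_add_scaleC(3)[OF 0 0, of "- 1"] by simp
  show "Gamma1 0 = 0" using Friedrichs_dom_add_scaleC(2)[OF 0 0, of "- 1"] by simp
  show "A_tilde_star \<phi> \<psi> 0 = 0"
    using Friedrichs_dom_add_scaleC(4)[OF 0 0, of \<phi> \<psi> "- 1"] by simp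
qed

lemma Friedrichs_dom_scaleC:
  assumes "v \<in> Friedrichs_dom"
  shows "a *\<^sub>C v \<in> Friedrichs_dom" "Gamma1 (a *\<^sub>C v) = a * Gamma1 v"
    "Gamma2 (a *\<^sub>C v) = a * Gamma2 v"
    "A_tilde_star \<phi> \<psi> (a *\<^sub>C v) = a *\<^sub>C A_tilde_star \<phi> \<psi> v"
proof -
  note l = Friedrichs_dom_add_scaleC[OF zero_in_Friedrichs_dom(1) assms]
  have e: "a *\<^sub>C v = 0 + a *\<^sub>C v" by simp
  show "a *\<^sub>C v \<in> Friedrichs_dom" by (subst e) (rule l(1))
  show "Gamma1 (a *\<^sub>C v) = a * Gamma1 v"
    by (subst e, subst l(2)) (simp only: zero_in_Friedrichs_dom add_0)
  show "Gamma2 (a *\<^sub>C v) = a * Gamma2 v"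
    by (subst e, subst l(3)) (simp only: zero_in_Friedrichs_dom add_0)
  show "A_tilde_star \<phi> \<psi> (a *\<^sub>C v) = a *\<^sub>C A_tilde_star \<phi> \<psi> v"
    by (subst e, subst l(4)) (simp only: zero_in_Friedrichs_dom add_0)
qed

lemma Friedrichs_dom_diff:
  assumes "u \<in> Friedrichs_dom" "v \<in> Friedrichs_dom"
  shows "u - v \<in> Friedrichs_dom" "Gamma1 (u - v) = Gamma1 u - Gamma1 v"
    "Gamma2 (u - v) = Gamma2 u - Gamma2 v"
    "A_tilde_star \<phi> \<psi> (u - v) = A_tilde_star \<phi> \<psi> u - A_tilde_star \<phi> \<psi> v"
proof -
  note l = Friedrichs_dom_add_scaleC[OF assms]
  have e: "u - v = u + (- 1) *\<^sub>C v" by simp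
  show "u - v \<in> Friedrichs_dom" unfolding e by (rule l(1))
  show "Gamma1 (u - v) = Gamma1 u - Gamma1 v" unfolding e l(2) by simp
  show "Gamma2 (u - v) = Gamma2 u - Gamma2 v" unfolding e l(3) by simp
  show "A_tilde_star \<phi> \<psi> (u - v) = A_tilde_star \<phi> \<psi> u - A_tilde_star \<phi> \<psi> v"
    unfolding e l(4) by simp
qed

lemma Friedrichs_dom_ker_L2:
  assumes "t \<noteq> 0"
  shows "ker_L2 t \<in> Friedrichs_dom" "Gamma2 (ker_L2 t) = 1"
    "Gamma1 (ker_L2 t) = \<i> * of_real (pi * sgn t)"
proof -
  have "mult_ker t 0 = 0" using mult_ker_scaleC[OF assms, of 0 0] by simp
  moreover have "cinner_L2 0 g = 0" for g using cinner_L2_scaleC_left[of 0 0 g] by simp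
  ultimately show "ker_L2 t \<in> Friedrichs_dom" "Gamma2 (ker_L2 t) = 1"
    "Gamma1 (ker_L2 t) = \<i> * of_real (pi * sgn t)"
    using Friedrichs_dom_mult_ker(1,2)[OF assms, of 0 1] Gamma1_mult_ker[OF assms, of 0 1]
    by simp_all
qed

section \<open>Resolvent set, solution operator and \<open>M\<close>-function\<close>

text \<open>The difference \<open>u - v\<close> lies in \<open>A_dom B\<close> and is annihilated by
  the operator minus \<open>z\<close>, so the resolvent bound makes it zero. Allowing arbitrary
  equal boundary values covers kernel vectors as well as resolvents.\<close>

lemma A_rho_unique:
  assumes z: "z \<in> A_rho \<phi> \<psi> B"
    and u: "u \<in> Friedrichs_dom" and v: "v \<in> Friedrichs_dom"
    and "Gamma1 u - B * Gamma2 u = Gamma1 v - B * Gamma2 v"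
    and "A_tilde_star \<phi> \<psi> u - z *\<^sub>C u = A_tilde_star \<phi> \<psi> v - z *\<^sub>C v"
  shows "u = v"
proof -
  obtain C where C: "\<And>u. u \<in> A_dom B \<Longrightarrow> norm u \<le> C * norm (A_tilde_star \<phi> \<psi> u - z *\<^sub>C u)"
    using z by (auto simp: A_rho_def resolvent_set_def)
  have "Gamma1 u - Gamma1 v = B * (Gamma2 u - Gamma2 v)"
    using assms(4) by (simp add: algebra_simps)
  then have "u - v \<in> A_dom B"
    by (simp add: A_dom_def Friedrichs_dom_diff[OF u v])
  moreover have "A_tilde_star \<phi> \<psi> (u - v) - z *\<^sub>C (u - v) = 0"
    using assms(5) unfolding Friedrichs_dom_diff(4)[OF u v] L2.scale_right_diff_distrib
    by (metis diff_diff_eq2 diff_add_eq add_diff_cancel_left' diff_self diff_add_cancel)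
  ultimately show ?thesis using C[of "u - v"] by simp
qed

lemma A_resolvent_props:
  assumes z: "z \<in> A_rho \<phi> \<psi> B"
  shows "A_resolvent \<phi> \<psi> B z g \<in> A_dom B"
    and "A_tilde_star \<phi> \<psi> (A_resolvent \<phi> \<psi> B z g) - z *\<^sub>C A_resolvent \<phi> \<psi> B z g = g"
proof -
  let ?f = "\<lambda>u. A_tilde_star \<phi> \<psi> u - z *\<^sub>C u"
  have "?f ` A_dom B = UNIV"
    using z by (simp add: A_rho_def resolvent_set_def bij_betw_def)
  then have g: "g \<in> ?f ` A_dom B" by simp
  show "A_resolvent \<phi> \<psi> B z g \<in> A_dom B"
    unfolding A_resolvent_def resolvent_def by (rule inv_into_into[OF g])
  show "?f (A_resolvent \<phi> \<psi> B z g) = g"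
    unfolding A_resolvent_def resolvent_def by (rule f_inv_into_f[OF g])
qed

lemma A_resolvent_eqI:
  assumes "z \<in> A_rho \<phi> \<psi> B" "u \<in> A_dom B" "A_tilde_star \<phi> \<psi> u - z *\<^sub>C u = g"
  shows "A_resolvent \<phi> \<psi> B z g = u"
proof (rule A_rho_unique[OF assms(1)])
  note r = A_resolvent_props[OF assms(1), of g]
  show "A_resolvent \<phi> \<psi> B z g \<in> Friedrichs_dom" "u \<in> Friedrichs_dom"
    using r(1) assms(2) by (auto simp: A_dom_def)
  show "Gamma1 (A_resolvent \<phi> \<psi> B z g) - B * Gamma2 (A_resolvent \<phi> \<psi> B z g)
      = Gamma1 u - B * Gamma2 u"
    using r(1) assms(2) by (simp add: A_dom_def)
  show "A_tilde_star \<phi> \<psi> (A_resolvent \<phi> \<psi> B z g) - z *\<^sub>C A_resolvent \<phi> \<psi> B z g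
      = A_tilde_star \<phi> \<psi> u - z *\<^sub>C u"
    unfolding r(2) assms(3) ..
qed

text \<open>From a vector \<open>u\<close> with nonzero boundary value, subtract the solution
  \<open>r\<close> of the same equation with zero boundary value; then rescale.\<close>

lemma kernel_vector_exists:
  assumes z: "z \<in> A_rho \<phi> \<psi> B"
  obtains v where "v \<in> op_kernel Friedrichs_dom (A_tilde_star \<phi> \<psi>) z"
    and "Gamma1 v - B * Gamma2 v = 1"
proof -
  \<comment> \<open>The ratios of \<open>Gamma1\<close> to \<open>Gamma2\<close> at
    \<open>ker_L2 1\<close> and \<open>ker_L2 (- 1)\<close> are i pi and -i pi, so at least one
    differs from \<open>B\<close>.\<close>
  have "\<exists>u \<in> Friedrichs_dom. Gamma1 u - B * Gamma2 u \<noteq> 0"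
  proof (cases "B = \<i> * of_real pi")
    case False
    then show ?thesis by (intro bexI[of _ "ker_L2 1"]) (simp_all add: Friedrichs_dom_ker_L2)
  next
    case True
    then show ?thesis by (intro bexI[of _ "ker_L2 (- 1)"]) (simp_all add: Friedrichs_dom_ker_L2)
  qed
  then obtain u where u: "u \<in> Friedrichs_dom" and Gu: "Gamma1 u - B * Gamma2 u \<noteq> 0" by blast
  define r where "r = A_resolvent \<phi> \<psi> B z (A_tilde_star \<phi> \<psi> u - z *\<^sub>C u)"
  have r: "r \<in> Friedrichs_dom" "Gamma1 r = B * Gamma2 r"
      "A_tilde_star \<phi> \<psi> r - z *\<^sub>C r = A_tilde_star \<phi> \<psi> u - z *\<^sub>C u"
    using A_resolvent_props[OF z] by (auto simp: r_def A_dom_def)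
  define a where "a = 1 / (Gamma1 u - B * Gamma2 u)"
  note d = Friedrichs_dom_diff[OF u r(1)] and s = Friedrichs_dom_scaleC[OF Friedrichs_dom_diff(1)[OF u r(1)], where a = a]
  have "A_tilde_star \<phi> \<psi> (a *\<^sub>C (u - r)) - z *\<^sub>C (a *\<^sub>C (u - r))
      = a *\<^sub>C ((A_tilde_star \<phi> \<psi> u - z *\<^sub>C u) - (A_tilde_star \<phi> \<psi> r - z *\<^sub>C r))"
    unfolding s(4) d(4) by (simp add: L2.scale_right_diff_distrib mult.commute)
  then have "a *\<^sub>C (u - r) \<in> op_kernel Friedrichs_dom (A_tilde_star \<phi> \<psi>) z"
    using s(1) r(3) by (simp add: op_kernel_def)
  moreover have "Gamma1 (a *\<^sub>C (u - r)) - B * Gamma2 (a *\<^sub>C (u - r)) = a * (Gamma1 u - B * Gamma2 u)"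
    unfolding s d using r(2) by (simp add: algebra_simps)
  ultimately show ?thesis using that Gu by (auto simp: a_def)
qed

text \<open>The kernel is one-dimensional because its elements are determined by their boundary
  value.\<close>

lemma kernel_proportional:
  assumes z: "z \<in> A_rho \<phi> \<psi> B"
    and u: "u \<in> op_kernel Friedrichs_dom (A_tilde_star \<phi> \<psi>) z"
    and v: "v \<in> op_kernel Friedrichs_dom (A_tilde_star \<phi> \<psi>) z" "Gamma1 v - B * Gamma2 v = 1"
  shows "u = (Gamma1 u - B * Gamma2 u) *\<^sub>C v"
proof (rule A_rho_unique[OF z])
  define a where "a = Gamma1 u - B * Gamma2 u"
  have V: "v \<in> Friedrichs_dom" using v by (simp add: op_kernel_def)
  show "u \<in> Friedrichs_dom" using u by (simp add: op_kernel_def)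
  show "(Gamma1 u - B * Gamma2 u) *\<^sub>C v \<in> Friedrichs_dom" by (rule Friedrichs_dom_scaleC[OF V])
  have "Gamma1 (a *\<^sub>C v) - B * Gamma2 (a *\<^sub>C v) = a * (Gamma1 v - B * Gamma2 v)"
    by (simp add: Friedrichs_dom_scaleC[OF V] algebra_simps)
  then show "Gamma1 u - B * Gamma2 u = Gamma1 ((Gamma1 u - B * Gamma2 u) *\<^sub>C v)
      - B * Gamma2 ((Gamma1 u - B * Gamma2 u) *\<^sub>C v)"
    using v(2) unfolding a_def[symmetric] by simp
  have "A_tilde_star \<phi> \<psi> (a *\<^sub>C v) - z *\<^sub>C (a *\<^sub>C v) = a *\<^sub>C (A_tilde_star \<phi> \<psi> v - z *\<^sub>C v)"
    by (simp add: Friedrichs_dom_scaleC[OF V] L2.scale_right_diff_distrib mult.commute)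
  then show "A_tilde_star \<phi> \<psi> u - z *\<^sub>C u = A_tilde_star \<phi> \<psi> ((Gamma1 u - B * Gamma2 u) *\<^sub>C v)
      - z *\<^sub>C ((Gamma1 u - B * Gamma2 u) *\<^sub>C v)"
    using u v unfolding a_def[symmetric] by (simp add: op_kernel_def)
qed

lemma M_function_eq:
  assumes z: "z \<in> A_rho \<phi> \<psi> B"
    and v: "v \<in> op_kernel Friedrichs_dom (A_tilde_star \<phi> \<psi>) z" "Gamma1 v - B * Gamma2 v = 1"
  shows "M_function \<phi> \<psi> B z = Gamma2 v"
  unfolding M_function_def
proof (rule the_equality)
  have V: "v \<in> Friedrichs_dom" using v by (simp add: op_kernel_def)
  show "\<forall>u\<in>op_kernel Friedrichs_dom (A_tilde_star \<phi> \<psi>) z. Gamma2 v * (Gamma1 u - B * Gamma2 u) = Gamma2 u"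
  proof
    fix u assume u: "u \<in> op_kernel Friedrichs_dom (A_tilde_star \<phi> \<psi>) z"
    have "Gamma2 u = Gamma2 ((Gamma1 u - B * Gamma2 u) *\<^sub>C v)"
      using kernel_proportional[OF z u v] by simp
    then show "Gamma2 v * (Gamma1 u - B * Gamma2 u) = Gamma2 u"
      using Friedrichs_dom_scaleC(3)[OF V] by (simp add: mult.commute)
  qed
next
  fix m assume "\<forall>u\<in>op_kernel Friedrichs_dom (A_tilde_star \<phi> \<psi>) z. m * (Gamma1 u - B * Gamma2 u) = Gamma2 u"
  from this[rule_format, OF v(1)] show "m = Gamma2 v" using v(2) by simp
qed

text \<open>Every kernel vector is the value of the solution operator at its own boundary value.
  This is what makes the resolvent hypothesis applicable to \<open>v\<close>.\<close>

lemma kernel_in_detectable_subspace: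
  assumes z: "z \<in> A_rho \<phi> \<psi> B"
    and v: "v \<in> op_kernel Friedrichs_dom (A_tilde_star \<phi> \<psi>) z"
  shows "v \<in> detectable_subspace \<phi> \<psi>"
proof -
  have "solution_op \<phi> \<psi> B z (Gamma1 v - B * Gamma2 v) = v"
    unfolding solution_op_def
    by (rule the_equality) (use v A_rho_unique[OF z, of _ v] in \<open>auto simp: op_kernel_def\<close>)
  then have "v \<in> range (solution_op \<phi> \<psi> B z)" by (metis rangeI)
  then have "v \<in> L2.span (\<Union>B. \<Union>z\<in>A_rho \<phi> \<psi> B. range (solution_op \<phi> \<psi> B z))"
    using z by (intro L2.span_base) blast
  then show ?thesis unfolding detectable_subspace_def by (rule closure_subset[THEN subsetD])
qed

section \<open>Kernel vectors at large imaginary points\<close>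

text \<open>
  A vector \<open>u\<close> with \<open>\<Gamma>\<^sub>2 u = 1\<close> is in the kernel at \<open>it\<close> iff \<open>(x - it) u = 1 - \<langle>u, \<phi>\<rangle> \<psi>\<close>.  Dividing by
  \<open>x - it\<close> and pairing with \<open>\<phi>\<close> gives \<open>ker_den \<cdot> \<langle>u, \<phi>\<rangle> = \<langle>ker_L2, \<phi>\<rangle>\<close>, so \<open>ker_coeff\<close> is \<open>\<langle>u, \<phi>\<rangle>\<close>.
\<close>

definition ker_den :: "L2 \<Rightarrow> L2 \<Rightarrow> real \<Rightarrow> complex" where
  "ker_den \<phi> \<psi> t = 1 + cinner_L2 (mult_ker t \<psi>) \<phi>"

definition ker_coeff :: "L2 \<Rightarrow> L2 \<Rightarrow> real \<Rightarrow> complex" where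
  "ker_coeff \<phi> \<psi> t = cinner_L2 (ker_L2 t) \<phi> / ker_den \<phi> \<psi> t"

definition ker_vec :: "L2 \<Rightarrow> L2 \<Rightarrow> real \<Rightarrow> L2" where
  "ker_vec \<phi> \<psi> t = ker_L2 t - ker_coeff \<phi> \<psi> t *\<^sub>C mult_ker t \<psi>"

lemma ker_vec_eq:
  assumes "t \<noteq> 0"
  shows "ker_vec \<phi> \<psi> t = mult_ker t ((- ker_coeff \<phi> \<psi> t) *\<^sub>C \<psi>) + 1 *\<^sub>C ker_L2 t"
  unfolding ker_vec_def mult_ker_scaleC[OF assms] by simp

lemma Gamma_ker_vec:
  assumes "t \<noteq> 0"
  shows "Gamma2 (ker_vec \<phi> \<psi> t) = 1"
    and "Gamma1 (ker_vec \<phi> \<psi> t)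
      = \<i> * of_real (pi * sgn t) - ker_coeff \<phi> \<psi> t * cinner_L2 \<psi> (ker_L2 (- t))"
  unfolding ker_vec_eq[OF assms] Gamma1_mult_ker[OF assms] Friedrichs_dom_mult_ker(2)[OF assms]
    cinner_L2_scaleC_left by simp_all

text \<open>The coefficient is self-consistent: the inner product of \<open>ker_vec\<close> with
  \<phi> equals \<open>ker_coeff\<close>, so the rank-one term cancels what the subtracted multiple
  of \<psi> produces.\<close>

lemma ker_vec_in_kernel:
  assumes t: "t \<noteq> 0" and d: "ker_den \<phi> \<psi> t \<noteq> 0"
  shows "ker_vec \<phi> \<psi> t \<in> op_kernel Friedrichs_dom (A_tilde_star \<phi> \<psi>) (\<i> * of_real t)"
proof -
  have "cinner_L2 (ker_vec \<phi> \<psi> t) \<phi> = ker_coeff \<phi> \<psi> t * ker_den \<phi> \<psi> t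
      - ker_coeff \<phi> \<psi> t * cinner_L2 (mult_ker t \<psi>) \<phi>"
    using d by (simp add: ker_vec_def cinner_L2_diff_left cinner_L2_scaleC_left ker_coeff_def)
  then have c: "cinner_L2 (ker_vec \<phi> \<psi> t) \<phi> = ker_coeff \<phi> \<psi> t"
    by (simp add: ker_den_def algebra_simps)
  have "ker_vec \<phi> \<psi> t \<in> Friedrichs_dom"
    unfolding ker_vec_eq[OF t] by (rule Friedrichs_dom_mult_ker(1)[OF t])
  moreover have "A_tilde_star \<phi> \<psi> (ker_vec \<phi> \<psi> t) - (\<i> * of_real t) *\<^sub>C ker_vec \<phi> \<psi> t
      = (- ker_coeff \<phi> \<psi> t) *\<^sub>C \<psi> + cinner_L2 (ker_vec \<phi> \<psi> t) \<phi> *\<^sub>C \<psi>"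
    using Friedrichs_dom_mult_ker(3)[OF t, of \<phi> \<psi> "(- ker_coeff \<phi> \<psi> t) *\<^sub>C \<psi>" 1]
    unfolding ker_vec_eq[OF t, symmetric] .
  ultimately show ?thesis by (simp add: op_kernel_def c)
qed

text \<open>The inverse is written down as in Krein's formula: solve first with
  \<open>Gamma2\<close> equal to 0, then repair the boundary condition by a multiple of the kernel
  vector.\<close>

lemma imaginary_in_A_rho:
  assumes t: "t \<noteq> 0" and d: "ker_den \<phi> \<psi> t \<noteq> 0" and B: "Gamma1 (ker_vec \<phi> \<psi> t) \<noteq> B"
  shows "\<i> * of_real t \<in> A_rho \<phi> \<psi> B"
proof -
  define z where "z = \<i> * complex_of_real t"
  define w where "w = ker_vec \<phi> \<psi> t"
  have w: "w \<in> Friedrichs_dom" "A_tilde_star \<phi> \<psi> w - z *\<^sub>C w = 0" "Gamma2 w = 1"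
    using ker_vec_in_kernel[OF t d] Gamma_ker_vec(1)[OF t] by (auto simp: op_kernel_def w_def z_def)
  \<comment> \<open>Pairing the equation p = (g - <p, \<phi>> \<psi>)/(x - it) with \<phi> and
    solving for <p, \<phi>> gives \<open>k g\<close>.\<close>
  define k where "k g = cinner_L2 (mult_ker t g) \<phi> / ker_den \<phi> \<psi> t" for g
  define h where "h g = g - k g *\<^sub>C \<psi>" for g
  define p where "p g = mult_ker t (h g)" for g
  \<comment> \<open>Since \<open>Gamma2 (p g) = 0\<close> and \<open>Gamma2 w = 1\<close>, this is
    the factor for which \<open>p g + a g *\<^sub>C w\<close> satisfies the boundary
    condition.\<close>
  define a where "a g = - Gamma1 (p g) / (Gamma1 w - B)" for g
  define u where "u g = p g + a g *\<^sub>C w" for g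
  have pk: "cinner_L2 (p g) \<phi> = k g" for g
  proof -
    have "cinner_L2 (p g) \<phi> = k g * ker_den \<phi> \<psi> t - k g * cinner_L2 (mult_ker t \<psi>) \<phi>"
      using d by (simp add: p_def h_def mult_ker_diff[OF t] mult_ker_scaleC[OF t]
          cinner_L2_diff_left cinner_L2_scaleC_left k_def)
    then show ?thesis by (simp add: ker_den_def algebra_simps)
  qed
  have p: "p g \<in> Friedrichs_dom" "Gamma2 (p g) = 0" "A_tilde_star \<phi> \<psi> (p g) - z *\<^sub>C p g = g"
    "Gamma1 (p g) = cinner_L2 (h g) (ker_L2 (- t))" for g
    using Friedrichs_dom_mult_ker[OF t, where h = "h g" and c = 0] pk[of g] Gamma1_mult_ker[OF t, of "h g" 0]
    by (simp_all add: p_def z_def h_def)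
  have u: "u g \<in> A_dom B" "A_tilde_star \<phi> \<psi> (u g) - z *\<^sub>C u g = g" for g
  proof -
    note l = Friedrichs_dom_add_scaleC[OF p(1)[of g] w(1), where a = "a g", folded u_def]
    have "a g * (Gamma1 w - B) = - Gamma1 (p g)" using B by (simp add: a_def w_def)
    then show "u g \<in> A_dom B" using l by (simp add: A_dom_def p w(3) algebra_simps)
    have "A_tilde_star \<phi> \<psi> (u g) - z *\<^sub>C u g
        = (A_tilde_star \<phi> \<psi> (p g) - z *\<^sub>C p g) + a g *\<^sub>C (A_tilde_star \<phi> \<psi> w - z *\<^sub>C w)"
      unfolding l by (simp add: u_def L2.scale_right_distrib L2.scale_right_diff_distrib mult.commute)
    then show "A_tilde_star \<phi> \<psi> (u g) - z *\<^sub>C u g = g" by (simp only: p w) simp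
  qed
  \<comment> \<open>The equation determines first <v, \<phi>> and then \<open>Gamma2 v\<close>, so
    \<open>v\<close> is forced. This yields injectivity and reduces the norm bound to one for
    \<open>u g\<close>.\<close>
  have unique: "v = u (A_tilde_star \<phi> \<psi> v - z *\<^sub>C v)" if v: "v \<in> A_dom B" for v
  proof -
    define g where "g = A_tilde_star \<phi> \<psi> v - z *\<^sub>C v"
    have v': "v \<in> Friedrichs_dom" "Gamma1 v = B * Gamma2 v" using v by (auto simp: A_dom_def)
    obtain f where f: "v = mult_ker t f + Gamma2 v *\<^sub>C ker_L2 t"
      using Friedrichs_domE[OF v'(1) t] .
    have "g = f + cinner_L2 v \<phi> *\<^sub>C \<psi>"
      using Friedrichs_dom_mult_ker(3)[OF t, of \<phi> \<psi> f "Gamma2 v", folded f]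
      by (simp add: g_def z_def)
    then have "f = g - cinner_L2 v \<phi> *\<^sub>C \<psi>" by simp
    then have v2: "v = mult_ker t g - cinner_L2 v \<phi> *\<^sub>C mult_ker t \<psi> + Gamma2 v *\<^sub>C ker_L2 t"
      using f by (simp add: mult_ker_diff[OF t] mult_ker_scaleC[OF t])
    from arg_cong[OF this, of "\<lambda>v. cinner_L2 v \<phi>"]
    have "cinner_L2 v \<phi> * ker_den \<phi> \<psi> t = cinner_L2 (mult_ker t g) \<phi> + Gamma2 v * cinner_L2 (ker_L2 t) \<phi>"
      by (simp add: cinner_L2_add_left cinner_L2_diff_left cinner_L2_scaleC_left ker_den_def algebra_simps)
    then have "cinner_L2 v \<phi> = k g + Gamma2 v * ker_coeff \<phi> \<psi> t"
      using d by (simp add: k_def ker_coeff_def divide_simps)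
    with v2 have v3: "v = p g + Gamma2 v *\<^sub>C w"
      by (simp add: p_def h_def mult_ker_diff[OF t] mult_ker_scaleC[OF t] w_def ker_vec_def
          L2.scale_left_distrib L2.scale_right_diff_distrib algebra_simps)
    have "Gamma1 v = Gamma1 (p g) + Gamma2 v * Gamma1 w"
      using arg_cong[OF v3, of Gamma1] Friedrichs_dom_add_scaleC(2)[OF p(1) w(1)] by simp
    then have "Gamma2 v * (Gamma1 w - B) = - Gamma1 (p g)"
      using v'(2) by (simp add: algebra_simps)
    then have "Gamma2 v = a g" using B by (simp add: a_def w_def divide_simps)
    with v3 show ?thesis unfolding u_def g_def[symmetric] by simp
  qed
  have bij: "bij_betw (\<lambda>u. A_tilde_star \<phi> \<psi> u - z *\<^sub>C u) (A_dom B) UNIV"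
    by (rule bij_betw_byWitness[where f' = u]) (use u unique in auto)
  define K where "K = norm \<phi> / (\<bar>t\<bar> * cmod (ker_den \<phi> \<psi> t))"
  have K: "cmod (k g) \<le> K * norm g" for g
  proof -
    have "cmod (cinner_L2 (mult_ker t g) \<phi>) \<le> norm g / \<bar>t\<bar> * norm \<phi>"
      by (rule order_trans[OF cmod_cinner_L2_le mult_right_mono[OF norm_mult_ker_le[OF t]]]) simp
    then show ?thesis using d t
      by (simp add: k_def K_def norm_divide divide_simps mult.commute mult.left_commute)
  qed
  have H: "norm (h g) \<le> (1 + K * norm \<psi>) * norm g" for g
  proof -
    have "norm (h g) \<le> norm g + cmod (k g) * norm \<psi>"
      unfolding h_def by (metis norm_triangle_ineq4 norm_scaleC_L2)
    also have "\<dots> \<le> norm g + K * norm g * norm \<psi>"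
      by (intro add_left_mono mult_right_mono K) simp
    finally show ?thesis by (simp add: algebra_simps)
  qed
  \<comment> \<open>The two summands bound \<open>p g\<close> and the boundary correction, each
    relative to \<open>norm (h g)\<close>.\<close>
  define L where "L = 1 / \<bar>t\<bar> + norm (ker_L2 (- t)) / cmod (Gamma1 w - B) * norm w"
  have L0: "0 \<le> L" by (simp add: L_def)
  have U: "norm (u g) \<le> L * ((1 + K * norm \<psi>) * norm g)" for g
  proof -
    have "cmod (a g) \<le> norm (h g) * norm (ker_L2 (- t)) / cmod (Gamma1 w - B)"
      unfolding a_def p norm_divide norm_minus_cancel
      by (intro divide_right_mono cmod_cinner_L2_le) simp
    then have "cmod (a g) * norm w \<le> norm (h g) * norm (ker_L2 (- t)) / cmod (Gamma1 w - B) * norm w"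
      by (rule mult_right_mono) simp
    moreover have "norm (u g) \<le> norm (p g) + cmod (a g) * norm w"
      unfolding u_def by (metis norm_triangle_ineq norm_scaleC_L2)
    moreover have "norm (p g) \<le> norm (h g) / \<bar>t\<bar>"
      unfolding p_def by (rule norm_mult_ker_le[OF t])
    ultimately have "norm (u g) \<le> L * norm (h g)" by (simp add: L_def algebra_simps)
    also have "\<dots> \<le> L * ((1 + K * norm \<psi>) * norm g)" by (rule mult_left_mono[OF H L0])
    finally show ?thesis .
  qed
  have "\<forall>v\<in>A_dom B. norm v \<le> (L * (1 + K * norm \<psi>)) * norm (A_tilde_star \<phi> \<psi> v - z *\<^sub>C v)"
    using U unique by (metis mult.assoc)
  with bij show ?thesis unfolding A_rho_def resolvent_set_def z_def by blast
qed

section \<open>Limits of the kernel vectors as |t| tends to infinity\<close>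

lemma bounded_bilinear_scaleC_L2: "bounded_bilinear scaleC_L2"
proof
  show "(a + a') *\<^sub>C f = a *\<^sub>C f + a' *\<^sub>C f" for a a' and f :: L2
    by (rule L2.scale_left_distrib)
  show "a *\<^sub>C (f + f') = a *\<^sub>C f + a *\<^sub>C f'" for a and f f' :: L2
    by (rule L2.scale_right_distrib)
  show "(r *\<^sub>R a) *\<^sub>C f = r *\<^sub>R a *\<^sub>C f" for r a and f :: L2
    by (simp add: scaleR_L2_def scaleR_conv_of_real)
  show "a *\<^sub>C (r *\<^sub>R f) = r *\<^sub>R a *\<^sub>C f" for r a and f :: L2
    by (simp add: scaleR_L2_def mult.commute)
  show "\<exists>K. \<forall>a (f :: L2). norm (a *\<^sub>C f) \<le> norm a * norm f * K"
    by (intro exI[of _ 1]) (simp add: norm_scaleC_L2)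
qed

lemmas tendsto_scaleC_L2 = bounded_bilinear.tendsto[OF bounded_bilinear_scaleC_L2]

lemma tendsto_cinner_L2_left:
  assumes "(f \<longlongrightarrow> l) F" shows "((\<lambda>t. cinner_L2 (f t) g) \<longlongrightarrow> cinner_L2 l g) F"
proof -
  have "bounded_linear (\<lambda>f. cinner_L2 f g)"
    by (rule bounded_linear_intro[where K = "norm g"])
      (auto simp: cinner_L2_add_left cinner_L2_scaleC_left scaleR_L2_def scaleR_conv_of_real
        cmod_cinner_L2_le)
  from bounded_linear.tendsto[OF this assms] show ?thesis .
qed

lemma eventually_nonzero_at_infinity: "\<forall>\<^sub>F t in at_infinity. t \<noteq> (0::real)"
  unfolding eventually_at_infinity by (intro exI[of _ 1]) auto

lemma tendsto_divide_abs_at_infinity: "((\<lambda>t::real. C / \<bar>t\<bar>) \<longlongrightarrow> 0) at_infinity"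
  using filterlim_at_top_imp_at_infinity[OF filterlim_norm_at_top[where ?'a = real]]
  by (intro tendsto_divide_0[OF tendsto_const]) (simp add: real_norm_def[abs_def])

text \<open>The norm decays like |t|^(-1/2). The sign \<open>s\<close> lets one statement serve both
  \<open>ker_L2 t\<close> and \<open>ker_L2 (- t)\<close>.\<close>

lemma tendsto_ker_L2:
  assumes "s = 1 \<or> s = - 1" shows "((\<lambda>t. ker_L2 (s * t)) \<longlongrightarrow> 0) at_infinity"
proof (rule tendsto_norm_zero_cancel, rule Lim_transform_eventually)
  define C where "C = (\<integral>x. inverse (1 + x\<^sup>2 :: real) \<partial>lborel)"
  show "\<forall>\<^sub>F t in at_infinity. sqrt (C / \<bar>t\<bar>) = norm (ker_L2 (s * t))"
    using eventually_nonzero_at_infinity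
  proof eventually_elim
    case (elim t)
    then have "(norm (ker_L2 (s * t)))\<^sup>2 = C / \<bar>t\<bar>"
      using assms norm_ker_L2_power2[of "s * t"] by (auto simp: C_def)
    then show ?case by (metis norm_ge_zero real_sqrt_unique)
  qed
  show "((\<lambda>t. sqrt (C / \<bar>t\<bar>)) \<longlongrightarrow> 0) at_infinity"
    using tendsto_real_sqrt[OF tendsto_divide_abs_at_infinity] by simp
qed

lemma tendsto_mult_ker: "((\<lambda>t. mult_ker t f) \<longlongrightarrow> 0) at_infinity"
proof (rule Lim_null_comparison[OF _ tendsto_divide_abs_at_infinity])
  show "\<forall>\<^sub>F t in at_infinity. norm (mult_ker t f) \<le> norm f / \<bar>t\<bar>"
    using eventually_nonzero_at_infinity by eventually_elim (rule norm_mult_ker_le)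
qed

lemma cinner_L2_zero_left: "cinner_L2 0 g = 0"
  using cinner_L2_scaleC_left[of 0 0 g] by simp

lemma tendsto_ker_den: "(ker_den \<phi> \<psi> \<longlongrightarrow> 1) at_infinity"
  using tendsto_add[OF tendsto_const tendsto_cinner_L2_left[OF tendsto_mult_ker[of \<psi>], of \<phi>], of 1]
  by (simp add: ker_den_def[abs_def] cinner_L2_zero_left)

lemma tendsto_ker_coeff: "(ker_coeff \<phi> \<psi> \<longlongrightarrow> 0) at_infinity"
  using tendsto_divide[OF tendsto_cinner_L2_left[OF tendsto_ker_L2[of 1], of \<phi>] tendsto_ker_den]
  by (simp add: ker_coeff_def[abs_def] cinner_L2_zero_left)

lemma tendsto_ker_vec: "(ker_vec \<phi> \<psi> \<longlongrightarrow> 0) at_infinity"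
  using tendsto_diff[OF tendsto_ker_L2[of 1] tendsto_scaleC_L2[OF tendsto_ker_coeff tendsto_mult_ker]]
  by (simp add: ker_vec_def[abs_def])

lemma eventually_ker_den_nonzero: "\<forall>\<^sub>F t in at_infinity. ker_den \<phi> \<psi> t \<noteq> 0"
  by (rule tendsto_imp_eventually_ne[OF tendsto_ker_den]) simp

text \<open>The correction due to the rank-one term is a product of two vanishing factors. The
  filter \<open>F\<close> stands for \<open>at_top\<close> or \<open>at_bot\<close>, where the sign
  of \<open>t\<close> is eventually constant.\<close>

lemma tendsto_Gamma1_ker_vec:
  assumes F: "F \<le> at_infinity" and s: "\<forall>\<^sub>F t in F. sgn t = s"
  shows "((\<lambda>t. Gamma1 (ker_vec \<phi> \<psi> t)) \<longlongrightarrow> \<i> * of_real (pi * s)) F"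
proof (rule Lim_transform_eventually)
  show "\<forall>\<^sub>F t in F. \<i> * of_real (pi * s) - ker_coeff \<phi> \<psi> t * cinner_L2 \<psi> (ker_L2 (- t))
      = Gamma1 (ker_vec \<phi> \<psi> t)"
    using s filter_leD[OF F eventually_nonzero_at_infinity]
    by eventually_elim (simp add: Gamma_ker_vec(2))
  have "((\<lambda>t. cinner_L2 \<psi> (ker_L2 (- t))) \<longlongrightarrow> 0) at_infinity"
  proof (rule Lim_null_comparison)
    show "\<forall>\<^sub>F t in at_infinity. norm (cinner_L2 \<psi> (ker_L2 (- t))) \<le> norm \<psi> * norm (ker_L2 (- 1 * t))"
      by (simp add: cmod_cinner_L2_le)
    show "((\<lambda>t. norm \<psi> * norm (ker_L2 (- 1 * t))) \<longlongrightarrow> 0) at_infinity"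
      by (intro tendsto_mult_right_zero tendsto_norm_zero tendsto_ker_L2) simp
  qed
  from tendsto_mult[OF tendsto_ker_coeff this]
  have "((\<lambda>t. ker_coeff \<phi> \<psi> t * cinner_L2 \<psi> (ker_L2 (- t))) \<longlongrightarrow> 0) F"
    by (intro tendsto_mono[OF F]) simp
  from tendsto_diff[OF tendsto_const this]
  show "((\<lambda>t. \<i> * of_real (pi * s) - ker_coeff \<phi> \<psi> t * cinner_L2 \<psi> (ker_L2 (- t)))
      \<longlongrightarrow> \<i> * of_real (pi * s)) F" by simp
qed

text \<open>Only the limit value of \<open>Gamma1\<close> obstructs a direction. As i pi and -i pi
  differ, every \<open>B\<close> admits at least one direction.\<close>

lemma eventually_imaginary_in_A_rho:
  assumes F: "F \<le> at_infinity" and s: "\<forall>\<^sub>F t in F. sgn t = s" and B: "B \<noteq> \<i> * of_real (pi * s)"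
  shows "\<forall>\<^sub>F t in F. \<i> * of_real t \<in> A_rho \<phi> \<psi> B"
proof -
  have "\<forall>\<^sub>F t in F. Gamma1 (ker_vec \<phi> \<psi> t) \<noteq> B"
    using B by (intro tendsto_imp_eventually_ne[OF tendsto_Gamma1_ker_vec[OF F s]]) simp
  with filter_leD[OF F eventually_nonzero_at_infinity] filter_leD[OF F eventually_ker_den_nonzero]
  show ?thesis by eventually_elim (rule imaginary_in_A_rho)
qed

section \<open>Comparing two models\<close>

text \<open>The choice of \<open>a\<close> puts \<open>v - a *\<^sub>C w\<close> in the first
  operator's domain, and dividing it by \<open>\<mu> - z\<close> gives the first resolvent at
  \<open>v\<close>. Being the second resolvent too, it meets the second boundary condition and
  equation.\<close>

lemma resolvents_agree_imp:
  assumes z1: "z \<in> A_rho \<phi>\<^sub>1 \<psi>\<^sub>1 B\<^sub>1" and z2: "z \<in> A_rho \<phi>\<^sub>2 \<psi>\<^sub>2 B\<^sub>2"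
    and v: "v \<in> op_kernel Friedrichs_dom (A_tilde_star \<phi>\<^sub>1 \<psi>\<^sub>1) \<mu>" and "\<mu> \<noteq> z"
    and w: "w \<in> op_kernel Friedrichs_dom (A_tilde_star \<phi>\<^sub>1 \<psi>\<^sub>1) z"
    and a: "Gamma1 v - B\<^sub>1 * Gamma2 v = a * (Gamma1 w - B\<^sub>1 * Gamma2 w)"
    and eq: "A_resolvent \<phi>\<^sub>1 \<psi>\<^sub>1 B\<^sub>1 z v = A_resolvent \<phi>\<^sub>2 \<psi>\<^sub>2 B\<^sub>2 z v"
  shows "cinner_L2 (v - a *\<^sub>C w) \<phi>\<^sub>1 *\<^sub>C \<psi>\<^sub>1 = cinner_L2 (v - a *\<^sub>C w) \<phi>\<^sub>2 *\<^sub>C \<psi>\<^sub>2"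
    and "Gamma1 v - a * Gamma1 w = B\<^sub>2 * (Gamma2 v - a * Gamma2 w)"
proof -
  define d where "d = v - a *\<^sub>C w"
  define b where "b = 1 / (\<mu> - z)"
  have V: "v \<in> Friedrichs_dom" "A_tilde_star \<phi>\<^sub>1 \<psi>\<^sub>1 v = \<mu> *\<^sub>C v"
    and W: "w \<in> Friedrichs_dom" "A_tilde_star \<phi>\<^sub>1 \<psi>\<^sub>1 w = z *\<^sub>C w"
    using v w by (auto simp: op_kernel_def)
  note aw = Friedrichs_dom_scaleC[OF W(1), where a = a]
  note d = Friedrichs_dom_diff[OF V(1) aw(1), folded d_def]
  note bd = Friedrichs_dom_scaleC[OF d(1), where a = b]
  have "A_tilde_star \<phi>\<^sub>1 \<psi>\<^sub>1 d - z *\<^sub>C d = (\<mu> - z) *\<^sub>C v"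
    unfolding d(4) aw(4) V(2) W(2) unfolding d_def
    by (simp add: L2.scale_right_diff_distrib L2.scale_left_diff_distrib mult.commute)
  then have "b *\<^sub>C (A_tilde_star \<phi>\<^sub>1 \<psi>\<^sub>1 d - z *\<^sub>C d) = v"
    using \<open>\<mu> \<noteq> z\<close> by (simp add: b_def)
  then have T1: "A_tilde_star \<phi>\<^sub>1 \<psi>\<^sub>1 (b *\<^sub>C d) - z *\<^sub>C (b *\<^sub>C d) = v"
    unfolding bd(4) by (simp add: L2.scale_right_diff_distrib mult.commute)
  have "Gamma1 d = B\<^sub>1 * Gamma2 d"
    unfolding d aw using a by (simp add: algebra_simps)
  then have "b *\<^sub>C d \<in> A_dom B\<^sub>1" using bd(1) by (simp add: A_dom_def bd(2,3))
  then have R: "A_resolvent \<phi>\<^sub>2 \<psi>\<^sub>2 B\<^sub>2 z v = b *\<^sub>C d"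
    using A_resolvent_eqI[OF z1 _ T1] eq by simp
  have "b *\<^sub>C d \<in> A_dom B\<^sub>2"
    using A_resolvent_props(1)[OF z2, of v] unfolding R .
  then have "b * Gamma1 d = b * (B\<^sub>2 * Gamma2 d)"
    by (simp add: A_dom_def bd(2,3) mult.left_commute)
  moreover have "b \<noteq> 0" using \<open>\<mu> \<noteq> z\<close> by (simp add: b_def)
  ultimately show "Gamma1 v - a * Gamma1 w = B\<^sub>2 * (Gamma2 v - a * Gamma2 w)"
    unfolding d(2,3) aw(2,3) by simp
  have "A_tilde_star \<phi>\<^sub>2 \<psi>\<^sub>2 (b *\<^sub>C d) - z *\<^sub>C (b *\<^sub>C d) = v"
    using A_resolvent_props(2)[OF z2, of v] unfolding R .
  with T1 have "A_tilde_star \<phi>\<^sub>1 \<psi>\<^sub>1 (b *\<^sub>C d) = A_tilde_star \<phi>\<^sub>2 \<psi>\<^sub>2 (b *\<^sub>C d)"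
    by (metis diff_add_cancel)
  \<comment> \<open>Both operators share the term \<open>xf - c\<close>, which cancels and leaves
    the rank-one parts.\<close>
  then have "cinner_L2 (b *\<^sub>C d) \<phi>\<^sub>1 *\<^sub>C \<psi>\<^sub>1 = cinner_L2 (b *\<^sub>C d) \<phi>\<^sub>2 *\<^sub>C \<psi>\<^sub>2"
    unfolding A_tilde_star_def by simp
  then have "b *\<^sub>C (cinner_L2 d \<phi>\<^sub>1 *\<^sub>C \<psi>\<^sub>1) = b *\<^sub>C (cinner_L2 d \<phi>\<^sub>2 *\<^sub>C \<psi>\<^sub>2)"
    unfolding cinner_L2_scaleC_left by simp
  then show "cinner_L2 (v - a *\<^sub>C w) \<phi>\<^sub>1 *\<^sub>C \<psi>\<^sub>1 = cinner_L2 (v - a *\<^sub>C w) \<phi>\<^sub>2 *\<^sub>C \<psi>\<^sub>2"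
    using \<open>b \<noteq> 0\<close> unfolding d_def[symmetric] by (simp only: L2.scale_cancel_left) simp
qed

theorem theorem4p1:
  fixes \<phi>\<^sub>1 \<psi>\<^sub>1 \<phi>\<^sub>2 \<psi>\<^sub>2 :: L2 and B\<^sub>1 B\<^sub>2 :: complex
    and S :: "L2 set" and \<rho>\<^sub>0 :: "complex set"
  assumes "A_rho \<phi>\<^sub>1 \<psi>\<^sub>1 B\<^sub>1 \<noteq> {}" and "A_rho \<phi>\<^sub>2 \<psi>\<^sub>2 B\<^sub>2 \<noteq> {}"
    and "detectable_subspace \<phi>\<^sub>1 \<psi>\<^sub>1 = S" and "detectable_subspace \<phi>\<^sub>2 \<psi>\<^sub>2 = S"
    and "A_rho \<phi>\<^sub>1 \<psi>\<^sub>1 B\<^sub>1 - \<real> = \<rho>\<^sub>0" and "A_rho \<phi>\<^sub>2 \<psi>\<^sub>2 B\<^sub>2 - \<real> = \<rho>\<^sub>0"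
    and "\<forall>z\<in>\<rho>\<^sub>0. \<forall>g\<in>S. A_resolvent \<phi>\<^sub>1 \<psi>\<^sub>1 B\<^sub>1 z g = A_resolvent \<phi>\<^sub>2 \<psi>\<^sub>2 B\<^sub>2 z g"
  shows "\<forall>z\<in>\<rho>\<^sub>0. M_function \<phi>\<^sub>1 \<psi>\<^sub>1 B\<^sub>1 z = M_function \<phi>\<^sub>2 \<psi>\<^sub>2 B\<^sub>2 z"
proof
  have rho1: "z \<in> \<rho>\<^sub>0 \<longleftrightarrow> z \<in> A_rho \<phi>\<^sub>1 \<psi>\<^sub>1 B\<^sub>1 \<and> z \<notin> \<real>" for z
    unfolding assms(5)[symmetric] by simp
  have rho2: "z \<in> \<rho>\<^sub>0 \<longleftrightarrow> z \<in> A_rho \<phi>\<^sub>2 \<psi>\<^sub>2 B\<^sub>2 \<and> z \<notin> \<real>" for z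
    unfolding assms(6)[symmetric] by simp
  fix \<mu> assume "\<mu> \<in> \<rho>\<^sub>0"
  then have \<mu>1: "\<mu> \<in> A_rho \<phi>\<^sub>1 \<psi>\<^sub>1 B\<^sub>1" and \<mu>2: "\<mu> \<in> A_rho \<phi>\<^sub>2 \<psi>\<^sub>2 B\<^sub>2"
    using rho1 rho2 by blast+
  obtain v where v: "v \<in> op_kernel Friedrichs_dom (A_tilde_star \<phi>\<^sub>1 \<psi>\<^sub>1) \<mu>"
    and Gv: "Gamma1 v - B\<^sub>1 * Gamma2 v = 1"
    by (rule kernel_vector_exists[OF \<mu>1])
  have vS: "v \<in> S" using kernel_in_detectable_subspace[OF \<mu>1 v] assms(3) by simp
  define w where "w = ker_vec \<phi>\<^sub>1 \<psi>\<^sub>1"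
  \<comment> \<open>As \<open>Gamma2 (w t) = 1\<close>, this factor gives
    \<open>a t *\<^sub>C w t\<close> the boundary value 1 of \<open>v\<close>, once the denominator
    is known to be nonzero.\<close>
  define a where "a t = 1 / (Gamma1 (w t) - B\<^sub>1)" for t

  \<comment> \<open>One nondegenerate \<open>B\<close> is enough: the resolvent sets agree off the
    real axis, so a nonreal point of either lies in both.\<close>
  have key: "\<forall>\<^sub>F t in F. cinner_L2 (v - a t *\<^sub>C w t) \<phi>\<^sub>1 *\<^sub>C \<psi>\<^sub>1 = cinner_L2 (v - a t *\<^sub>C w t) \<phi>\<^sub>2 *\<^sub>C \<psi>\<^sub>2
      \<and> Gamma1 v - a t * Gamma1 (w t) = B\<^sub>2 * (Gamma2 v - a t)
      \<and> Gamma1 v - a t * Gamma1 (w t) = B\<^sub>1 * (Gamma2 v - a t)"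
    if F: "F \<le> at_infinity" and s: "\<forall>\<^sub>F t in F. sgn t = s"
      and B: "B\<^sub>1 \<noteq> \<i> * of_real (pi * s) \<or> B\<^sub>2 \<noteq> \<i> * of_real (pi * s)" for F s
  proof -
    note nz = filter_leD[OF F eventually_nonzero_at_infinity]
    have "\<forall>\<^sub>F t in F. \<i> * of_real t \<in> A_rho \<phi>\<^sub>1 \<psi>\<^sub>1 B\<^sub>1 \<or> \<i> * of_real t \<in> A_rho \<phi>\<^sub>2 \<psi>\<^sub>2 B\<^sub>2"
      using B
    proof
      assume "B\<^sub>1 \<noteq> \<i> * of_real (pi * s)"
      from eventually_imaginary_in_A_rho[OF F s this] show ?thesis
        by (rule eventually_mono) blast
    next
      assume "B\<^sub>2 \<noteq> \<i> * of_real (pi * s)"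
      from eventually_imaginary_in_A_rho[OF F s this] show ?thesis
        by (rule eventually_mono) blast
    qed
    then have rho: "\<forall>\<^sub>F t in F. \<i> * of_real t \<in> \<rho>\<^sub>0" using nz
    proof eventually_elim
      case (elim t)
      then have "\<i> * of_real t \<notin> \<real>" by (simp add: complex_is_Real_iff)
      then show ?case using elim(1) rho1 rho2 by blast
    qed
    have "\<forall>\<^sub>F t in at_infinity. \<mu> \<noteq> \<i> * of_real t"
      unfolding eventually_at_infinity
    proof (intro exI[of _ "cmod \<mu> + 1"] allI impI notI)
      fix t :: real assume "norm t \<ge> cmod \<mu> + 1" "\<mu> = \<i> * of_real t"
      then show False by (simp add: norm_mult)
    qed
    note ne = filter_leD[OF F this]
    show ?thesis
      using rho nz ne filter_leD[OF F eventually_ker_den_nonzero[of \<phi>\<^sub>1 \<psi>\<^sub>1]]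
    proof eventually_elim
      case (elim t)
      have z: "\<i> * of_real t \<in> A_rho \<phi>\<^sub>1 \<psi>\<^sub>1 B\<^sub>1" "\<i> * of_real t \<in> A_rho \<phi>\<^sub>2 \<psi>\<^sub>2 B\<^sub>2"
        using rho1[THEN iffD1, OF elim(1)] rho2[THEN iffD1, OF elim(1)]
        by (simp_all only:)
      have wt: "w t \<in> op_kernel Friedrichs_dom (A_tilde_star \<phi>\<^sub>1 \<psi>\<^sub>1) (\<i> * of_real t)"
        unfolding w_def by (rule ker_vec_in_kernel[OF elim(2,4)])
      have G2: "Gamma2 (w t) = 1" unfolding w_def by (rule Gamma_ker_vec(1)[OF elim(2)])
      \<comment> \<open>Otherwise \<open>w t\<close> would be an eigenvector of the first operator
        at a point of its resolvent set.\<close>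
      have "Gamma1 (w t) - B\<^sub>1 \<noteq> 0"
      proof
        assume G0: "Gamma1 (w t) - B\<^sub>1 = 0"
        have "w t = 0"
        proof (rule A_rho_unique[OF z(1)])
          show "w t \<in> Friedrichs_dom" using wt unfolding op_kernel_def by blast
          show "0 \<in> Friedrichs_dom" by (rule zero_in_Friedrichs_dom)
          show "Gamma1 (w t) - B\<^sub>1 * Gamma2 (w t) = Gamma1 0 - B\<^sub>1 * Gamma2 0"
            unfolding G2 mult_1_right G0 by (simp add: zero_in_Friedrichs_dom)
          have "A_tilde_star \<phi>\<^sub>1 \<psi>\<^sub>1 (w t) - (\<i> * of_real t) *\<^sub>C w t = 0"
            using wt unfolding op_kernel_def by blast
          then show "A_tilde_star \<phi>\<^sub>1 \<psi>\<^sub>1 (w t) - (\<i> * of_real t) *\<^sub>C w t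
              = A_tilde_star \<phi>\<^sub>1 \<psi>\<^sub>1 0 - (\<i> * of_real t) *\<^sub>C 0"
            by (simp only: zero_in_Friedrichs_dom L2.scale_zero_right diff_self)
        qed
        then show False using G2 zero_in_Friedrichs_dom(2) by simp
      qed
      then have at: "Gamma1 v - B\<^sub>1 * Gamma2 v = a t * (Gamma1 (w t) - B\<^sub>1 * Gamma2 (w t))"
        by (simp add: Gv G2 a_def)
      have "A_resolvent \<phi>\<^sub>1 \<psi>\<^sub>1 B\<^sub>1 (\<i> * of_real t) v = A_resolvent \<phi>\<^sub>2 \<psi>\<^sub>2 B\<^sub>2 (\<i> * of_real t) v"
        using assms(7) elim(1) vS by blast
      note r = resolvents_agree_imp[OF z v elim(3) wt at this]
      have "Gamma1 v = a t * (Gamma1 (w t) - B\<^sub>1) + B\<^sub>1 * Gamma2 v"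
        using at by (simp only: G2 diff_eq_eq mult_1_right)
      then have "Gamma1 v - a t * Gamma1 (w t) = B\<^sub>1 * (Gamma2 v - a t)"
        by (simp only:) (simp add: algebra_simps)
      with r(1) r(2)[unfolded G2 mult_1_right] show ?case by (intro conjI)
    qed
  qed

  have top: "(at_top :: real filter) \<le> at_infinity" "\<forall>\<^sub>F t::real in at_top. sgn t = 1"
    by (rule at_top_le_at_infinity, rule eventually_mono[OF eventually_gt_at_top[of 0]]) simp
  have bot: "(at_bot :: real filter) \<le> at_infinity" "\<forall>\<^sub>F t::real in at_bot. sgn t = - 1"
    by (rule at_bot_le_at_infinity, rule eventually_mono[OF eventually_gt_at_bot[of 0]]) simp

  \<comment> \<open>The direction is chosen so that the denominator of \<open>a\<close> has a
    nonzero limit; then \<open>a\<close> stays bounded while \<open>w\<close> tends to 0.\<close>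
  obtain F :: "real filter" and s where F: "F \<le> at_infinity" "F \<noteq> bot" and s: "\<forall>\<^sub>F t in F. sgn t = s"
    and Bs: "B\<^sub>1 \<noteq> \<i> * of_real (pi * s)"
  proof (cases "B\<^sub>1 = \<i> * of_real (pi * 1)")
    case True
    then show ?thesis using that[OF bot(1) _ bot(2)] by simp
  next
    case False
    then show ?thesis using that[OF top(1) _ top(2)] by simp
  qed
  have "(a \<longlongrightarrow> 1 / (\<i> * of_real (pi * s) - B\<^sub>1)) F"
    unfolding a_def[abs_def] w_def using Bs
    by (intro tendsto_intros tendsto_Gamma1_ker_vec[OF F(1) s]) auto
  from tendsto_scaleC_L2[OF this tendsto_mono[OF F(1) tendsto_ker_vec[of \<phi>\<^sub>1 \<psi>\<^sub>1]]]
  have "((\<lambda>t. v - a t *\<^sub>C w t) \<longlongrightarrow> v - 0) F"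
    unfolding w_def by (intro tendsto_diff tendsto_const) simp
  then have d: "((\<lambda>t. v - a t *\<^sub>C w t) \<longlongrightarrow> v) F" by simp
  have "cinner_L2 v \<phi>\<^sub>1 *\<^sub>C \<psi>\<^sub>1 = cinner_L2 v \<phi>\<^sub>2 *\<^sub>C \<psi>\<^sub>2"
  proof (rule tendsto_unique[OF F(2)])
    show "((\<lambda>t. cinner_L2 (v - a t *\<^sub>C w t) \<phi>\<^sub>2 *\<^sub>C \<psi>\<^sub>2) \<longlongrightarrow> cinner_L2 v \<phi>\<^sub>2 *\<^sub>C \<psi>\<^sub>2) F"
      by (intro tendsto_scaleC_L2 tendsto_cinner_L2_left d tendsto_const)
    have "((\<lambda>t. cinner_L2 (v - a t *\<^sub>C w t) \<phi>\<^sub>1 *\<^sub>C \<psi>\<^sub>1) \<longlongrightarrow> cinner_L2 v \<phi>\<^sub>1 *\<^sub>C \<psi>\<^sub>1) F"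
      by (intro tendsto_scaleC_L2 tendsto_cinner_L2_left d tendsto_const)
    then show "((\<lambda>t. cinner_L2 (v - a t *\<^sub>C w t) \<phi>\<^sub>2 *\<^sub>C \<psi>\<^sub>2) \<longlongrightarrow> cinner_L2 v \<phi>\<^sub>1 *\<^sub>C \<psi>\<^sub>1) F"
      by (rule Lim_transform_eventually) (rule eventually_mono[OF key[OF F(1) s disjI1[OF Bs]]], blast)
  qed
  then have v2: "v \<in> op_kernel Friedrichs_dom (A_tilde_star \<phi>\<^sub>2 \<psi>\<^sub>2) \<mu>"
    using v by (simp add: op_kernel_def A_tilde_star_def)

  have "B\<^sub>1 = B\<^sub>2"
  proof (rule ccontr)
    assume ne: "B\<^sub>1 \<noteq> B\<^sub>2"
    \<comment> \<open>Distinct \<open>B\<^sub>1\<close> and \<open>B\<^sub>2\<close> cannot both be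
      the degenerate value, so \<open>key\<close> is available in both directions.\<close>
    have lim: "Gamma1 v = Gamma2 v * (\<i> * of_real (pi * s))"
      if F: "F \<le> at_infinity" "F \<noteq> bot" and s: "\<forall>\<^sub>F t in F. sgn t = s" for F s
    proof (rule tendsto_unique[OF F(2)])
      show "((\<lambda>t. Gamma2 v * Gamma1 (w t)) \<longlongrightarrow> Gamma2 v * (\<i> * of_real (pi * s))) F"
        unfolding w_def by (intro tendsto_intros tendsto_Gamma1_ker_vec[OF F(1) s])
      have "B\<^sub>1 \<noteq> \<i> * of_real (pi * s) \<or> B\<^sub>2 \<noteq> \<i> * of_real (pi * s)" using ne by blast
      from key[OF F(1) s this] have "\<forall>\<^sub>F t in F. Gamma1 v = Gamma2 v * Gamma1 (w t)"
      proof eventually_elim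
        case (elim t)
        then have "B\<^sub>1 * (Gamma2 v - a t) = B\<^sub>2 * (Gamma2 v - a t)" by (metis (no_types))
        then have "Gamma2 v = a t" using ne by simp
        then have "Gamma1 v - a t * Gamma1 (w t) = 0" using elim by (simp only: diff_self mult_zero_right)
        then show ?case using \<open>Gamma2 v = a t\<close> by (simp only: right_minus_eq)
      qed
      then show "((\<lambda>t. Gamma2 v * Gamma1 (w t)) \<longlongrightarrow> Gamma1 v) F"
        by (rule Lim_transform_eventually[OF tendsto_const])
    qed
    have "Gamma1 v = Gamma2 v * (\<i> * of_real (pi * 1))" by (rule lim[OF top(1) _ top(2)]) simp
    moreover have "Gamma1 v = Gamma2 v * (\<i> * of_real (pi * - 1))" by (rule lim[OF bot(1) _ bot(2)]) simp
    ultimately have "Gamma2 v = 0" "Gamma1 v = 0" by auto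
    with Gv show False by simp
  qed
  \<comment> \<open>With equal boundary parameters \<open>v\<close> is a normalised kernel vector
    for both models, and both functions take the value \<open>Gamma2 v\<close>.\<close>
  with M_function_eq[OF \<mu>1 v Gv] M_function_eq[OF \<mu>2 v2] Gv
  show "M_function \<phi>\<^sub>1 \<psi>\<^sub>1 B\<^sub>1 \<mu> = M_function \<phi>\<^sub>2 \<psi>\<^sub>2 B\<^sub>2 \<mu>" by simp
qed

end
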